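(* Let $d\ge1$ and let $\mu$ be a probability measure on the configuration space $\mathsf{S}$ over $\mathbb{R}^d$ supported on configurations with infinitely many particles. Assume: (i) $\mu$ is translation invariant: $\mu\circ\theta_x^{-1}=\mu$ for each $x\in\mathbb{R}^d$; (ii) $(\mathcal{E}^{\mu},\mathcal{D}_\circ^{\mu})$ is closable on $L^2(\mathsf{S},\mu)$; (iii) for each $n\in\mathbb{N}$ the $n$-point correlation function $\rho^n$ of $\mu$ exists and is locally bounded; (iv) $\mathrm{Cap}(\mathcal{N}_1)=0$, where $\mathcal{N}_1=\{\mathsf{s}\in\mathsf{S}:\ \mathsf{s}(\{x\})\ge 2\text{ for some }x\in\mathbb{R}^d\}$; (v) $(\mathcal{E}^{[1]},\mathcal{D}_\circ^{[1]})$ is closable on $L^2(\mathbb{R}^d\times\mathsf{S},\mu^{[1]})$. Let $\mathbf{X}=(X^i)_{i\in\mathbb{Z}}$ be the labeled process of the $\mu$-reversible diffusion $\mathsf{X}$ with label $\mathfrak{l}=(\mathfrak{l}_i)_{i\in\mathbb{Z}}$, and let $\hat a$ be the matrix-valued function on $\mathsf{S}$ described in the context. Then for each $i\in\mathbb{Z}$, $$\lim_{\epsilon\to0}\epsilon X^i_{\cdot/\epsilon^2}=\sqrt{\hat a\bigl(\theta_{-\mathfrak{l}_i(\mathsf{s})}(\mathsf{s}-\delta_{\mathfrak{l}_i(\mathsf{s})})\bigr)}\,B\quad\text{weakly in }C([0,\infty);\mathbb{R}^d)$$ under $\mathsf{P}_{\mathsf{s}}$ in $\mu$-probability, that is, for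 every bounded continuous $F:C([0,\infty);\mathbb{R}^d)\to\mathbb{R}$ and every $\kappa>0$, $$\lim_{\epsilon\to0}\mu\Bigl(\Bigl\{\mathsf{s}:\ \Bigl|\mathsf{E}_{\mathsf{s}}[F(\epsilon X^i_{\cdot/\epsilon^2})]-E\bigl[F\bigl(\sqrt{\hat a(\theta_{-\mathfrak{l}_i(\mathsf{s})}(\mathsf{s}-\delta_{\mathfrak{l}_i(\mathsf{s})}))}\,B\bigr)\bigr]\Bigr|\ge\kappa\Bigr\}\Bigr)=0.$$ Here $B$ is a standard $d$-dimensional Brownian motion, $E$ is the expectation with respect to $B$, and $\mathsf{E}_{\mathsf{s}}$ is the expectation with respect to $\mathsf{P}_{\mathsf{s}}$.
   Context: Configuration space: $\mathsf{S}=\{\mathsf{s}=\sum_i\delta_{s_i}:\ s_i\in\mathbb{R}^d,\ \mathsf{s}(\{|x|\le r\})<\infty\text{ for all }r\in\mathbb{N}\}$ with the vague topology (a Polish space). $\theta_x:\mathsf{S}\to\mathsf{S}$ is the shift $\theta_x(\sum_i\delta_{s_i})=\sum_i\delta_{s_i+x}$. Correlation functions: symmetric, locally integrable $\rho^n:(\mathbb{R}^d)^n\to[0,\infty)$ is the $n$-point correlation function of $\mu$ if $\int_{A_1^{k_1}\times\cdots\times A_m^{k_m}}\rho^n\,dx_1\cdots dx_n=\int_{\mathsf{S}}\prod_{i=1}^m\frac{\mathsf{s}(A_i)!}{(\mathsf{s}(A_i)-k_i)!}\,d\mu$ for all disjoint bounded measurable $A_1,\dots,A_m$ and natural numbers $k_1+\cdots+k_m=n$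 (the quotient is $0$ if $\mathsf{s}(A_i)<k_i$). Local smooth functions: for $f$ on $\mathsf{S}$, $\check f$ is the symmetric function with $\check f(s_1,s_2,\dots)=f(\mathsf{s})$, $\mathsf{s}=\sum_i\delta_{s_i}$. $f$ is smooth if $\check f$ is smooth, and local if $f=f\circ\pi_r$ for some $r$, where $\pi_r(\mathsf{s})=\mathsf{s}(\cdot\cap\{|x|\le r\})$. $\mathcal{D}_\circ$ is the set of smooth local functions. For $f,g\in\mathcal{D}_\circ$ set $\mathbb{D}[f,g](\mathsf{s})=\frac12\sum_i\frac{\partial\check f}{\partial s_i}\cdot\frac{\partial\check g}{\partial s_i}(\mathsf{s})$. Dirichlet form: $\mathcal{E}^\mu(f,g)=\int_{\mathsf{S}}\mathbb{D}[f,g]\,d\mu$, $\mathcal{D}^\mu_\circ=\{f\in\mathcal{D}_\circ:\ f\in L^2(\mathsf{S},\mu),\ \mathcal{E}^\mu(f,f)<\infty\}$. Under (ii) and (iii) the closure $(\mathcal{E}^\mu,\mathcal{D}^\mu)$ is a quasi-regular Dirichlet form on $L^2(\mathsf{S},\mu)$, so there is an associated $\mu$-reversible diffusion $\mathsf{X}=\{\mathsf{X}_t\}$ with laws $\mathsf{P}=\{\mathsf{P}_{\mathsf{s}}\}_{\mathsf{s}\in\mathsf{S}}$, $\mathsf{P}_{\mathsf{s}}$ being the law starting at $\mathsf{s}$. $\mathrm{Cap}$ is the 1-capacity of $(\mathcal{E}^\mu,\mathcal{D}^\mu,L^2(\mathsf{S},\mu))$. One-Campbell form: $\mu_x=\mu(\cdot-\delta_x\mid\mathsf{s}(\{x\})\ge1)$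 is the reduced Palm measure of $\mu$ conditioned at $x$ (with the version $\mu_x=\mu_0\circ\theta_x^{-1}$, $\mu$ being translation invariant), and $\mu^{[1]}(dx\,d\mathsf{s})=\rho^1(x)\mu_x(d\mathsf{s})dx$. $\mathcal{E}^{[1]}(f,g)=\int_{\mathbb{R}^d\times\mathsf{S}}\{\frac12\nabla_xf\cdot\nabla_xg+\mathbb{D}[f,g]\}\,d\mu^{[1]}$, with $\mathbb{D}$ acting on the $\mathsf{s}$ variable, and $\mathcal{D}^{[1]}_\circ=\{f\in C_0^\infty(\mathbb{R}^d)\otimes\mathcal{D}_\circ:\ f\in L^2(\mathbb{R}^d\times\mathsf{S},\mu^{[1]}),\ \mathcal{E}^{[1]}(f,f)<\infty\}$. Label and labeled process: let $\mathsf{S}_{\mathrm{s.i}}=\{\mathsf{s}:\ \mathsf{s}(\{x\})\le1\text{ for all }x,\ \mathsf{s}(\mathbb{R}^d)=\infty\}$; then $\mu(\mathsf{S}_{\mathrm{s.i}})=1$. A label is a measurable map $\mathfrak{l}=(\mathfrak{l}_i)_{i\in\mathbb{Z}}:\mathsf{S}_{\mathrm{s.i}}\to(\mathbb{R}^d)^{\mathbb{Z}}$ with $\sum_i\delta_{\mathfrak{l}_i(\mathsf{s})}=\mathsf{s}$; one label is fixed. Under the assumptions the particles of $\mathsf{X}$ neither collide nor explode (for quasi-every starting point), so $\mathsf{X}_t=\sum_{i\in\mathbb{Z}}\delta_{X^i_t}$ with continuous paths $X^i$ such that $X^i_0=\mathfrak{l}_i(\mathsf{s})$ when $\mathsf{X}_0=\mathsf{s}$;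 $\mathbf{X}=(X^i)_{i\in\mathbb{Z}}$ is the labeled process. Tagged particle and environment process: for $f\in\mathcal{D}_\circ$ let $D^{\mathrm{sft}}f=(D^{\mathrm{sft}}_1f,\dots,D^{\mathrm{sft}}_df)$, $D^{\mathrm{sft}}_kf(\mathsf{s})=\lim_{\epsilon\to0}\frac1\epsilon\{f(\theta_{\epsilon\mathbf{e}_k}(\mathsf{s}))-f(\mathsf{s})\}$, with $\mathbf{e}_k$ the $k$th unit vector. For $f,g\in C_0^\infty(\mathbb{R}^d)\otimes\mathcal{D}_\circ$ set $$\mathcal{E}_{X\mathsf{Y}}(f,g)=\int_{\mathbb{R}^d\times\mathsf{S}}\Bigl\{\tfrac12(\nabla_x-D^{\mathrm{sft}})f\cdot(\nabla_x-D^{\mathrm{sft}})g+\mathbb{D}[f,g]\Bigr\}\,dx\,d\mu_0 .$$ It is known that, under (i)–(v), this form (on functions in $C_0^\infty(\mathbb{R}^d)\otimes\mathcal{D}_\circ$ in $L^2(\mathbb{R}^d\times\mathsf{S},dx\,d\mu_0)$ with finite energy) is closable on $L^2(\mathbb{R}^d\times\mathsf{S},dx\,d\mu_0)$ and that its closure is associated with a diffusion $(X,\mathsf{Y})=\{(X_t,\mathsf{Y}_t)\}$; it is the process consisting of the tagged particle $X=X^0$ and the environment $\mathsf{Y}_t=\sum_{i\ne0}\delta_{X^i_t-X^0_t}$ seen from it. $\mathsf{P}^{X\mathsf{Y}}_{(x,\mathsf{s})}$ is its law starting at $(x,\mathsf{s})$, with expectation $\mathsf{E}^{X\mathsf{Y}}_{(x,\mathsf{s})}$.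 Versions are fixed such that $\mathsf{P}_{\mathsf{s}}\circ\theta_x^{-1}=\mathsf{P}_{\theta_x(\mathsf{s})}$, such that the law of $(X-X_0,\mathsf{Y})$ under $\mathsf{P}^{X\mathsf{Y}}_{(x,\mathsf{s})}$ does not depend on $x$, and such that for each $x\in\mathbb{R}^d$ and $\mathsf{s}\in\mathsf{S}_{\mathrm{s.i}}$ with $\mathsf{s}(\{x\})=1$ the law of $X^{j}$ under $\mathsf{P}_{\mathsf{s}}$, where $j$ is the index with $\mathfrak{l}_j(\mathsf{s})=x$, equals the law of $X$ under $\mathsf{P}^{X\mathsf{Y}}_{(x,\theta_{-x}(\mathsf{s}-\delta_x))}$. The function $\hat a$: by a known invariance principle, under (i)–(v) there exists a non-negative definite $d\times d$-matrix-valued function $\hat a$ on $\mathsf{S}$ such that, for each $x\in\mathbb{R}^d$, every bounded continuous $F$ on $C([0,\infty);\mathbb{R}^d)$ and every $\kappa>0$, $$\lim_{\epsilon\to0}\mu_0\bigl(\{\mathsf{s}:\ |\mathsf{E}^{X\mathsf{Y}}_{(x,\mathsf{s})}[F(\epsilon X_{\cdot/\epsilon^2}-\epsilon X_0)]-E[F(\sqrt{\hat a(\mathsf{s})}B)]|\ge\kappa\}\bigr)=0 .$$ This $\hat a$ is the function in the claim. *)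

theory Defs
  imports "HOL-Probability.Probability" "HOL-Combinatorics.Permutations"
begin

section \<open>Configurations on the Euclidean space\<close>

text \<open>A configuration \<open>s = \<Sum>\<^sub>i \<delta>(s\<^sub>i)\<close> is encoded by its multiplicity function \<open>x \<mapsto> s({x})\<close>. The
  dimension \<open>d\<close> is \<open>CARD('n) \<ge> 1\<close>.\<close>

typedef (overloaded) 'n config =
  "{s :: real ^ 'n::finite \<Rightarrow> nat. \<forall>r::nat. finite {x. norm x \<le> r \<and> s x \<noteq> 0}}"
  morphisms mult Abs_config
  by (rule exI[of _ "\<lambda>_. 0"]) simp

setup_lifting type_definition_config

text \<open>The vague topology: the coarsest topology making all maps \<open>s \<mapsto> \<integral>\<phi> ds\<close> continuous, with
  \<open>\<phi>\<close> continuous of compact support. The sum below ranges over a finite set.\<close>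

definition config_integral :: "'n::finite config \<Rightarrow> (real ^ 'n \<Rightarrow> real) \<Rightarrow> real" where
  "config_integral s \<phi> = (\<Sum>x | mult s x \<noteq> 0 \<and> \<phi> x \<noteq> 0. real (mult s x) * \<phi> x)"

instantiation config :: (finite) topological_space
begin

definition open_config :: "'a config set \<Rightarrow> bool" where
  "open_config = generate_topology
     {{s. config_integral s \<phi> \<in> U} | \<phi> U.
        continuous_on UNIV \<phi> \<and> compact (closure {x. \<phi> x \<noteq> 0}) \<and> open U}"

instance
proof
  show "open (UNIV :: 'a config set)"
    unfolding open_config_def by (rule generate_topology.UNIV)
  show "open (S \<inter> T)" if "open S" "open T" for S T :: "'a config set"
    using that unfolding open_config_def by (rule generate_topology.Int)
  show "open (\<Union>K)" if "\<forall>S\<in>K. open S" for K :: "'a config set set"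
    using that unfolding open_config_def by (auto intro: generate_topology.UN)
qed

end

definition config_count :: "'n::finite config \<Rightarrow> (real ^ 'n) set \<Rightarrow> nat" where
  \<comment> \<open>\<open>s(A)\<close>, used for bounded \<open>A\<close> only\<close>
  "config_count s A = (\<Sum>x | x \<in> A \<and> mult s x \<noteq> 0. mult s x)"

lift_definition shift :: "real ^ 'n \<Rightarrow> 'n::finite config \<Rightarrow> 'n config"
  is "\<lambda>v s y. s (y - v)"
proof -
  fix v :: "real ^ 'n::finite" and s :: "real ^ 'n \<Rightarrow> nat" and r :: nat
  assume s: "\<And>r::nat. finite {x. norm x \<le> r \<and> s x \<noteq> 0}"
  obtain m :: nat where m: "real r + norm v \<le> m"
    using real_arch_simple by blast
  have "{y. norm y \<le> r \<and> s (y - v) \<noteq> 0} \<subseteq> (\<lambda>x. x + v) ` {x. norm x \<le> m \<and> s x \<noteq> 0}"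
  proof
    fix y assume y: "y \<in> {y. norm y \<le> r \<and> s (y - v) \<noteq> 0}"
    have "norm (y - v) \<le> m"
      using y m norm_triangle_ineq4[of y v] by auto
    then show "y \<in> (\<lambda>x. x + v) ` {x. norm x \<le> m \<and> s x \<noteq> 0}"
      using y by (intro image_eqI[of _ _ "y - v"]) auto
  qed
  then show "finite {y. norm y \<le> r \<and> s (y - v) \<noteq> 0}"
    by (rule finite_subset) (use s in auto)
qed

lift_definition restrict_config :: "real \<Rightarrow> 'n::finite config \<Rightarrow> 'n config"
  is "\<lambda>r s y. if norm y \<le> r then s y else 0"
  by (auto intro: rev_finite_subset)

lift_definition remove_point :: "real ^ 'n \<Rightarrow> 'n::finite config \<Rightarrow> 'n config"
  is "\<lambda>x s. s(x := s x - 1)"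
proof -
  fix x :: "real ^ 'n::finite" and s :: "real ^ 'n \<Rightarrow> nat" and r :: nat
  assume s: "\<And>r::nat. finite {x. norm x \<le> r \<and> s x \<noteq> 0}"
  show "finite {y. norm y \<le> r \<and> (s(x := s x - 1)) y \<noteq> 0}"
    by (rule finite_subset[OF _ s[of r]]) (auto split: if_splits)
qed

text \<open>\<open>add_points s n x = s + \<Sum>\<^bsub>i<n\<^esub> \<delta>(x i)\<close>\<close>

lift_definition add_points :: "'n::finite config \<Rightarrow> nat \<Rightarrow> (nat \<Rightarrow> real ^ 'n) \<Rightarrow> 'n config"
  is "\<lambda>s n x y. s y + card {i. i < n \<and> x i = y}"
proof -
  fix s :: "real ^ 'n::finite \<Rightarrow> nat" and n r :: nat and x :: "nat \<Rightarrow> real ^ 'n"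
  assume s: "\<And>r::nat. finite {x. norm x \<le> r \<and> s x \<noteq> 0}"
  have "{y. norm y \<le> r \<and> s y + card {i. i < n \<and> x i = y} \<noteq> 0}
      \<subseteq> {x. norm x \<le> r \<and> s x \<noteq> 0} \<union> x ` {..<n}"
    by auto
  then show "finite {y. norm y \<le> r \<and> s y + card {i. i < n \<and> x i = y} \<noteq> 0}"
    by (rule finite_subset) (use s in auto)
qed

definition infinite_config :: "'n::finite config \<Rightarrow> bool" where
  "infinite_config s \<longleftrightarrow> infinite {x. mult s x \<noteq> 0}"

definition S_si :: "'n::finite config set" where
  "S_si = {s. (\<forall>x. mult s x \<le> 1) \<and> infinite_config s}"

definition environment :: "'n::finite config \<Rightarrow> real ^ 'n \<Rightarrow> 'n config" where
  "environment s x = shift (- x) (remove_point x s)"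

definition is_label :: "('n::finite config \<Rightarrow> int \<Rightarrow> real ^ 'n) \<Rightarrow> bool" where
  "is_label l \<longleftrightarrow>
     l \<in> restrict_space borel S_si \<rightarrow>\<^sub>M (\<Pi>\<^sub>M i\<in>UNIV. borel) \<and>
     (\<forall>s\<in>S_si. \<forall>x. finite {i. l s i = x} \<and> card {i. l s i = x} = mult s x)"


section \<open>Correlation functions and Palm measures\<close>

text \<open>Points of \<open>(\<real>\<^sup>d)\<^sup>n\<close> are the extensional functions on \<open>{..<n}\<close>.\<close>

definition falling :: "nat \<Rightarrow> nat \<Rightarrow> real" where
  "falling N k = (if k \<le> N then fact N / fact (N - k) else 0)"

definition block_product ::
    "nat \<Rightarrow> nat \<Rightarrow> (nat \<Rightarrow> nat) \<Rightarrow> (nat \<Rightarrow> (real ^ 'n::finite) set) \<Rightarrow> (nat \<Rightarrow> real ^ 'n) set" where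
  \<comment> \<open>\<open>A\<^sub>0\<^bsup>k 0\<^esup> \<times> \<dots> \<times> A\<^bsub>m-1\<^esub>\<^bsup>k (m-1)\<^esup>\<close> as a subset of \<open>(\<real>\<^sup>d)\<^sup>n\<close>\<close>
  "block_product n m k A = {x \<in> extensional {..<n}.
     \<forall>j<m. \<forall>i\<in>{(\<Sum>a<j. k a)..<(\<Sum>a<Suc j. k a)}. x i \<in> A j}"

definition correlation_function ::
    "'n::finite config measure \<Rightarrow> nat \<Rightarrow> ((nat \<Rightarrow> real ^ 'n) \<Rightarrow> real) \<Rightarrow> bool" where
  "correlation_function \<mu> n \<rho> \<longleftrightarrow>
     \<rho> \<in> borel_measurable (\<Pi>\<^sub>M i\<in>{..<n}. lborel) \<and>
     (\<forall>x\<in>extensional {..<n}. 0 \<le> \<rho> x) \<and>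
     (\<forall>\<pi>. \<pi> permutes {..<n} \<longrightarrow> (\<forall>x\<in>extensional {..<n}. \<rho> (\<lambda>i\<in>{..<n}. x (\<pi> i)) = \<rho> x)) \<and>
     (\<forall>R. set_integrable (\<Pi>\<^sub>M i\<in>{..<n}. lborel)
        {x \<in> extensional {..<n}. \<forall>i<n. norm (x i) \<le> R} \<rho>) \<and>
     (\<forall>m k A. (\<forall>j<m. A j \<in> sets borel \<and> bounded (A j)) \<longrightarrow> disjoint_family_on A {..<m} \<longrightarrow>
        (\<Sum>j<m. k j) = n \<longrightarrow>
        (\<integral>\<^sup>+x. ennreal (\<rho> x) * indicator (block_product n m k A) x \<partial>(\<Pi>\<^sub>M i\<in>{..<n}. lborel)) =
        (\<integral>\<^sup>+s. ennreal (\<Prod>j<m. falling (config_count s (A j)) (k j)) \<partial>\<mu>))"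

definition locally_bounded :: "nat \<Rightarrow> ((nat \<Rightarrow> real ^ 'n::finite) \<Rightarrow> real) \<Rightarrow> bool" where
  "locally_bounded n \<rho> \<longleftrightarrow>
     (\<forall>R. \<exists>C. \<forall>x\<in>extensional {..<n}. (\<forall>i<n. norm (x i) \<le> R) \<longrightarrow> \<bar>\<rho> x\<bar> \<le> C)"

definition one_point :: "(nat \<Rightarrow> (nat \<Rightarrow> real ^ 'n::finite) \<Rightarrow> real) \<Rightarrow> real ^ 'n \<Rightarrow> real" where
  "one_point \<rho> x = \<rho> 1 (\<lambda>i\<in>{..<1}. x)"

definition palm :: "'n::finite config measure \<Rightarrow> real ^ 'n \<Rightarrow> 'n config measure" where
  "palm \<mu>\<^sub>0 x = distr \<mu>\<^sub>0 borel (shift x)"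

text \<open>The reduced Palm measures \<open>\<mu>\<^sub>x = \<mu>(\<cdot> - \<delta>\<^sub>x | s({x}) \<ge> 1)\<close> are conditionings on null events; as
  usual they are given by disintegrating the reduced Campbell measure with respect to its
  intensity \<open>\<rho>\<^sup>1(x) dx\<close>. The inner integral over the counting measure is
  \<open>\<Sum>\<^sub>i 1\<^sub>A(s\<^sub>i) 1\<^sub>C(s - \<delta>(s\<^sub>i))\<close>. The version with \<open>\<mu>\<^sub>x = \<mu>\<^sub>0 \<circ> \<theta>\<^sub>x\<^sup>-\<^sup>1\<close> is built in.\<close>

definition reduced_palm ::
    "'n::finite config measure \<Rightarrow> (real ^ 'n \<Rightarrow> real) \<Rightarrow> 'n config measure \<Rightarrow> bool" where
  "reduced_palm \<mu> \<rho>1 \<mu>\<^sub>0 \<longleftrightarrow> prob_space \<mu>\<^sub>0 \<and> sets \<mu>\<^sub>0 = sets borel \<and>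
     (\<forall>A\<in>sets borel. \<forall>C\<in>sets borel.
        (\<integral>\<^sup>+s. (\<integral>\<^sup>+x. of_nat (mult s x) * indicator A x * indicator C (remove_point x s)
                  \<partial>count_space UNIV) \<partial>\<mu>) =
        (\<integral>\<^sup>+x. ennreal (\<rho>1 x) * emeasure (palm \<mu>\<^sub>0 x) C * indicator A x \<partial>lborel))"

definition one_campbell ::
    "(real ^ 'n \<Rightarrow> real) \<Rightarrow> 'n::finite config measure \<Rightarrow> ((real ^ 'n) \<times> 'n config) measure" where
  "one_campbell \<rho>1 \<mu>\<^sub>0 = measure_of UNIV (sets (lborel \<Otimes>\<^sub>M \<mu>\<^sub>0))
     (\<lambda>C. \<integral>\<^sup>+x. ennreal (\<rho>1 x) * emeasure (palm \<mu>\<^sub>0 x) {s. (x, s) \<in> C} \<partial>lborel)"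


section \<open>Smooth local functions\<close>

text \<open>Iterated partial derivatives. A direction is given by the family of lines
  \<open>h \<mapsto> v x h\<close> through the points \<open>x\<close>; smoothness (\<open>C\<^sup>\<infinity>\<close>) means that all iterated partial
  derivatives exist and are continuous.\<close>

primrec iterated_partial :: "('b \<Rightarrow> real \<Rightarrow> 'b) list \<Rightarrow> ('b \<Rightarrow> real) \<Rightarrow> 'b \<Rightarrow> real" where
  "iterated_partial [] f = f"
| "iterated_partial (v # vs) f = (\<lambda>x. deriv (\<lambda>h. iterated_partial vs f (v x h)) 0)"

definition smooth_along ::
    "('b::topological_space \<Rightarrow> real \<Rightarrow> 'b) set \<Rightarrow> ('b \<Rightarrow> real) \<Rightarrow> bool" where
  "smooth_along V f \<longleftrightarrow>
     (\<forall>vs\<in>lists V. continuous_on UNIV (iterated_partial vs f) \<and>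
        (\<forall>v\<in>V. \<forall>x. (\<lambda>h. iterated_partial vs f (v x h)) differentiable (at 0)))"

definition smooth_compact_support :: "(real ^ 'n::finite \<Rightarrow> real) set" where
  "smooth_compact_support = {\<phi>. smooth_along {\<lambda>x h. x + h *\<^sub>R axis k 1 | k. True} \<phi> \<and>
     compact (closure {x. \<phi> x \<noteq> 0})}"

text \<open>\<open>f\<close> is smooth if the symmetric function \<open>(s\<^sub>1, s\<^sub>2, \<dots>) \<mapsto> f(\<Sum>\<^sub>i \<delta>(s\<^sub>i))\<close> is smooth in
  any finitely many of its (finitely or infinitely many) arguments, the others being fixed and
  forming the configuration \<open>s\<close>. Functions of \<open>n\<close> points are functions on \<open>nat \<Rightarrow> real ^ 'n\<close> (with
  the product topology) that depend on the first \<open>n\<close> coordinates only.\<close>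

definition smooth_config_fun :: "('n::finite config \<Rightarrow> real) \<Rightarrow> bool" where
  "smooth_config_fun f \<longleftrightarrow> (\<forall>s n. smooth_along
     {\<lambda>x h. x(i := x i + h *\<^sub>R axis k 1) | i k. i < n} (\<lambda>x. f (add_points s n x)))"

definition local_config_fun :: "('n::finite config \<Rightarrow> real) \<Rightarrow> bool" where
  "local_config_fun f \<longleftrightarrow> (\<exists>r. \<forall>s. f (restrict_config r s) = f s)"

definition D_loc :: "('n::finite config \<Rightarrow> real) set" where
  "D_loc = {f. smooth_config_fun f \<and> local_config_fun f}"

definition tensor_loc :: "((real ^ 'n::finite) \<times> 'n config \<Rightarrow> real) set" where
  \<comment> \<open>the algebraic tensor product \<open>C\<^sub>0\<^sup>\<infinity>(\<real>\<^sup>d) \<otimes> D\<^sub>\<circ>\<close>\<close>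
  "tensor_loc = {\<lambda>(x, s). \<Sum>j<m. \<phi> j x * f j s | (m::nat) \<phi> f.
     (\<forall>j<m. \<phi> j \<in> smooth_compact_support \<and> f j \<in> D_loc)}"

definition particle_partial ::
    "('n::finite config \<Rightarrow> real) \<Rightarrow> 'n config \<Rightarrow> real ^ 'n \<Rightarrow> 'n \<Rightarrow> real" where
  "particle_partial f s x k =
     deriv (\<lambda>h. f (add_points (remove_point x s) 1 (\<lambda>_. x + h *\<^sub>R axis k 1))) 0"

text \<open>The square field \<open>D[f, g](s)\<close>. The sum over the particles is grouped by location; for local
  functions only finitely many terms are nonzero.\<close>

definition square_field ::
    "('n::finite config \<Rightarrow> real) \<Rightarrow> ('n config \<Rightarrow> real) \<Rightarrow> 'n config \<Rightarrow> real" where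
  "square_field f g s = 1 / 2 * (\<Sum>\<^sub>\<infinity>x. real (mult s x) *
     (\<Sum>k\<in>UNIV. particle_partial f s x k * particle_partial g s x k))"

definition space_partial ::
    "((real ^ 'n::finite) \<times> 'n config \<Rightarrow> real) \<Rightarrow> real ^ 'n \<Rightarrow> 'n config \<Rightarrow> 'n \<Rightarrow> real" where
  "space_partial f x s k = deriv (\<lambda>h. f (x + h *\<^sub>R axis k 1, s)) 0"

definition shift_partial :: "('n::finite config \<Rightarrow> real) \<Rightarrow> 'n config \<Rightarrow> 'n \<Rightarrow> real" where
  "shift_partial f s k = Lim (at 0) (\<lambda>\<epsilon>. (f (shift (\<epsilon> *\<^sub>R axis k 1) s) - f s) / \<epsilon>)"

definition square_field_campbell ::
    "((real ^ 'n::finite) \<times> 'n config \<Rightarrow> real) \<Rightarrow> ((real ^ 'n) \<times> 'n config \<Rightarrow> real) \<Rightarrow>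
       (real ^ 'n) \<times> 'n config \<Rightarrow> real" where
  "square_field_campbell f g = (\<lambda>(x, s).
     1 / 2 * (\<Sum>k\<in>UNIV. space_partial f x s k * space_partial g x s k) +
     square_field (\<lambda>s. f (x, s)) (\<lambda>s. g (x, s)) s)"

definition square_field_tagged ::
    "((real ^ 'n::finite) \<times> 'n config \<Rightarrow> real) \<Rightarrow> ((real ^ 'n) \<times> 'n config \<Rightarrow> real) \<Rightarrow>
       (real ^ 'n) \<times> 'n config \<Rightarrow> real" where
  "square_field_tagged f g = (\<lambda>(x, s).
     1 / 2 * (\<Sum>k\<in>UNIV.
       (space_partial f x s k - shift_partial (\<lambda>s. f (x, s)) s k) *
       (space_partial g x s k - shift_partial (\<lambda>s. g (x, s)) s k)) +
     square_field (\<lambda>s. f (x, s)) (\<lambda>s. g (x, s)) s)"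


section \<open>Dirichlet forms\<close>

definition square_integrable :: "'x measure \<Rightarrow> ('x \<Rightarrow> real) \<Rightarrow> bool" where
  "square_integrable M f \<longleftrightarrow> f \<in> borel_measurable M \<and> integrable M (\<lambda>x. (f x)\<^sup>2)"

definition L2_dist :: "'x measure \<Rightarrow> ('x \<Rightarrow> real) \<Rightarrow> ('x \<Rightarrow> real) \<Rightarrow> real" where
  "L2_dist M f g = sqrt (\<integral>x. (f x - g x)\<^sup>2 \<partial>M)"

definition energy ::
    "'x measure \<Rightarrow> (('x \<Rightarrow> real) \<Rightarrow> ('x \<Rightarrow> real) \<Rightarrow> 'x \<Rightarrow> real) \<Rightarrow> ('x \<Rightarrow> real) \<Rightarrow> ('x \<Rightarrow> real) \<Rightarrow> real" where
  "energy M \<Gamma> f g = (\<integral>x. \<Gamma> f g x \<partial>M)"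

definition energy_domain ::
    "'x measure \<Rightarrow> (('x \<Rightarrow> real) \<Rightarrow> ('x \<Rightarrow> real) \<Rightarrow> 'x \<Rightarrow> real) \<Rightarrow> ('x \<Rightarrow> real) set \<Rightarrow> ('x \<Rightarrow> real) set" where
  "energy_domain M \<Gamma> C = {f \<in> C. square_integrable M f \<and> integrable M (\<Gamma> f f)}"

type_synonym 'x form = "('x \<Rightarrow> real) \<Rightarrow> ('x \<Rightarrow> real) \<Rightarrow> real"

definition form_Cauchy :: "'x form \<Rightarrow> (nat \<Rightarrow> 'x \<Rightarrow> real) \<Rightarrow> bool" where
  "form_Cauchy E u \<longleftrightarrow> (\<forall>e>0. \<exists>N. \<forall>m\<ge>N. \<forall>n\<ge>N.
     E (\<lambda>x. u m x - u n x) (\<lambda>x. u m x - u n x) < e)"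

definition closable :: "'x measure \<Rightarrow> ('x \<Rightarrow> real) set \<Rightarrow> 'x form \<Rightarrow> bool" where
  "closable M D E \<longleftrightarrow> (\<forall>u. (\<forall>n. u n \<in> D) \<longrightarrow> form_Cauchy E u \<longrightarrow>
     (\<lambda>n. L2_dist M (u n) (\<lambda>_. 0)) \<longlonglongrightarrow> 0 \<longrightarrow> (\<lambda>n. E (u n) (u n)) \<longlonglongrightarrow> 0)"

definition approximates ::
    "'x measure \<Rightarrow> ('x \<Rightarrow> real) set \<Rightarrow> 'x form \<Rightarrow> (nat \<Rightarrow> 'x \<Rightarrow> real) \<Rightarrow> ('x \<Rightarrow> real) \<Rightarrow> bool" where
  "approximates M D E u f \<longleftrightarrow>
     (\<forall>n. u n \<in> D) \<and> form_Cauchy E u \<and> (\<lambda>n. L2_dist M (u n) f) \<longlonglongrightarrow> 0"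

definition closure_domain :: "'x measure \<Rightarrow> ('x \<Rightarrow> real) set \<Rightarrow> 'x form \<Rightarrow> ('x \<Rightarrow> real) set" where
  "closure_domain M D E = {f. square_integrable M f \<and> (\<exists>u. approximates M D E u f)}"

definition closure_form :: "'x measure \<Rightarrow> ('x \<Rightarrow> real) set \<Rightarrow> 'x form \<Rightarrow> 'x form" where
  "closure_form M D E f g = (THE L. \<forall>u v. approximates M D E u f \<longrightarrow> approximates M D E v g \<longrightarrow>
     (\<lambda>n. E (u n) (v n)) \<longlonglongrightarrow> L)"

definition capacity ::
    "'x::topological_space measure \<Rightarrow> ('x \<Rightarrow> real) set \<Rightarrow> 'x form \<Rightarrow> 'x set \<Rightarrow> ennreal" where
  "capacity M D E A = (INF U\<in>{U. open U \<and> A \<subseteq> U}.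
     INF f\<in>{f \<in> D. AE x in M. x \<in> U \<longrightarrow> 1 \<le> f x}. ennreal (E f f + (\<integral>x. (f x)\<^sup>2 \<partial>M)))"

text \<open>The strongly continuous contraction semigroup on \<open>L\<^sup>2(M)\<close> of a closed form: its generator is
  the operator \<open>u \<mapsto> g\<close> with \<open>E u v = - (g, v)\<close> for all \<open>v\<close> in the domain of the form.\<close>

definition form_semigroup ::
    "'x measure \<Rightarrow> ('x \<Rightarrow> real) set \<Rightarrow> 'x form \<Rightarrow> (real \<Rightarrow> ('x \<Rightarrow> real) \<Rightarrow> 'x \<Rightarrow> real) \<Rightarrow> bool" where
  "form_semigroup M D E T \<longleftrightarrow>
     (\<forall>t\<ge>0. \<forall>f. square_integrable M f \<longrightarrow> square_integrable M (T t f) \<and>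
        L2_dist M (T t f) (\<lambda>_. 0) \<le> L2_dist M f (\<lambda>_. 0)) \<and>
     (\<forall>t\<ge>0. \<forall>f g a b. square_integrable M f \<longrightarrow> square_integrable M g \<longrightarrow>
        (AE x in M. T t (\<lambda>x. a * f x + b * g x) x = a * T t f x + b * T t g x)) \<and>
     (\<forall>f. square_integrable M f \<longrightarrow> (AE x in M. T 0 f x = f x)) \<and>
     (\<forall>r\<ge>0. \<forall>t\<ge>0. \<forall>f. square_integrable M f \<longrightarrow> (AE x in M. T (r + t) f x = T r (T t f) x)) \<and>
     (\<forall>f. square_integrable M f \<longrightarrow> ((\<lambda>t. L2_dist M (T t f) f) \<longlongrightarrow> 0) (at_right 0)) \<and>
     (\<forall>u g. square_integrable M u \<longrightarrow> square_integrable M g \<longrightarrow>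
        (((\<lambda>t. L2_dist M (\<lambda>x. (T t u x - u x) / t) g) \<longlongrightarrow> 0) (at_right 0) \<longleftrightarrow>
         u \<in> D \<and> (\<forall>v\<in>D. E u v = - (\<integral>x. g x * v x \<partial>M))))"


section \<open>Path spaces and diffusions\<close>

text \<open>\<open>C([0, \<infinity>); 'a)\<close>: a path is a function on the real line, continuous on \<open>[0, \<infinity>)\<close> and (to make
  the representation unique) constant on \<open>(-\<infinity>, 0]\<close>. The compact-open topology is the topology of
  locally uniform convergence if \<open>'a\<close> is metric.\<close>

typedef (overloaded) 'a cpath =
  "{w :: real \<Rightarrow> 'a::topological_space. continuous_on {0..} w \<and> (\<forall>t<0. w t = w 0)}"
  morphisms path_at Abs_cpath
  by (rule exI[of _ "\<lambda>_. undefined"]) simp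

setup_lifting type_definition_cpath

instantiation cpath :: (topological_space) topological_space
begin

definition open_cpath :: "'a cpath set \<Rightarrow> bool" where
  "open_cpath = generate_topology
     {{w. path_at w ` K \<subseteq> U} | K U. compact K \<and> K \<subseteq> {0..} \<and> open U}"

instance
proof
  show "open (UNIV :: 'a cpath set)"
    unfolding open_cpath_def by (rule generate_topology.UNIV)
  show "open (S \<inter> T)" if "open S" "open T" for S T :: "'a cpath set"
    using that unfolding open_cpath_def by (rule generate_topology.Int)
  show "open (\<Union>K)" if "\<forall>S\<in>K. open S" for K :: "'a cpath set set"
    using that unfolding open_cpath_def by (auto intro: generate_topology.UN)
qed

end

text \<open>\<open>map_path f w = f \<circ> w\<close>; used for continuous \<open>f\<close> only.\<close>

definition map_path :: "('a::topological_space \<Rightarrow> 'b::topological_space) \<Rightarrow> 'a cpath \<Rightarrow> 'b cpath" where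
  "map_path f w = Abs_cpath (\<lambda>t. f (path_at w t))"

lift_definition rescale :: "real \<Rightarrow> 'a::real_normed_vector cpath \<Rightarrow> 'a cpath"
  is "\<lambda>\<epsilon> w t. \<epsilon> *\<^sub>R w (t / \<epsilon>\<^sup>2)"
proof
  fix \<epsilon> :: real and w :: "real \<Rightarrow> 'a"
  assume w: "continuous_on {0..} w \<and> (\<forall>t<0. w t = w 0)"
  have "continuous_on {0..} (\<lambda>t. w (t * inverse (\<epsilon>\<^sup>2)))"
    by (rule continuous_on_compose2[of "{0..}" w]) (use w in \<open>auto intro!: continuous_intros\<close>)
  then show "continuous_on {0..} (\<lambda>t. \<epsilon> *\<^sub>R w (t / \<epsilon>\<^sup>2))"
    by (auto intro!: continuous_intros simp: divide_inverse)
  show "\<forall>t<0. \<epsilon> *\<^sub>R w (t / \<epsilon>\<^sup>2) = \<epsilon> *\<^sub>R w (0 / \<epsilon>\<^sup>2)"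
  proof (intro allI impI)
    fix t :: real assume "t < 0"
    then show "\<epsilon> *\<^sub>R w (t / \<epsilon>\<^sup>2) = \<epsilon> *\<^sub>R w (0 / \<epsilon>\<^sup>2)"
      using w by (cases "\<epsilon> = 0") (auto simp: divide_neg_pos)
  qed
qed

lift_definition path_after :: "real \<Rightarrow> 'a::topological_space cpath \<Rightarrow> 'a cpath"
  is "\<lambda>r w t. w (max 0 r + max 0 t)"
proof
  fix r :: real and w :: "real \<Rightarrow> 'a"
  assume w: "continuous_on {0..} w \<and> (\<forall>t<0. w t = w 0)"
  show "continuous_on {0..} (\<lambda>t. w (max 0 r + max 0 t))"
    by (rule continuous_on_compose2[of "{0..}" w]) (use w in \<open>auto intro!: continuous_intros\<close>)
  show "\<forall>t<0. w (max 0 r + max 0 t) = w (max 0 r + max 0 0)"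
    by auto
qed

definition past :: "real \<Rightarrow> 'a::topological_space cpath set set" where
  "past t = sigma_sets UNIV {{w. path_at w u \<in> A} | u A. 0 \<le> u \<and> u \<le> t \<and> A \<in> sets borel}"

definition past_right :: "real \<Rightarrow> 'a::topological_space cpath set set" where
  "past_right t = (\<Inter>u\<in>{t<..}. past u)"

text \<open>A diffusion: a strong Markov family of laws on the space of continuous paths. It suffices to
  state the strong Markov property for finite stopping times.\<close>

definition diffusion :: "('a::topological_space \<Rightarrow> 'a cpath measure) \<Rightarrow> bool" where
  "diffusion P \<longleftrightarrow>
     P \<in> borel \<rightarrow>\<^sub>M prob_algebra borel \<and>
     (\<forall>s. AE w in P s. path_at w 0 = s) \<and>
     (\<forall>\<tau>. (\<forall>w. 0 \<le> \<tau> w) \<longrightarrow> (\<forall>t. {w. \<tau> w \<le> t} \<in> past_right t) \<longrightarrow>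
        (\<forall>A. (\<forall>t. A \<inter> {w. \<tau> w \<le> t} \<in> past_right t) \<longrightarrow>
          (\<forall>G\<in>sets borel. \<forall>s.
             emeasure (P s) (A \<inter> {w. path_after (\<tau> w) w \<in> G}) =
             (\<integral>\<^sup>+w. emeasure (P (path_at w (\<tau> w))) G * indicator A w \<partial>P s))))"

definition transition ::
    "('a::topological_space \<Rightarrow> 'a cpath measure) \<Rightarrow> real \<Rightarrow> ('a \<Rightarrow> real) \<Rightarrow> 'a \<Rightarrow> real" where
  "transition P t f s = (\<integral>w. f (path_at w t) \<partial>P s)"

definition associated ::
    "'a::topological_space measure \<Rightarrow> ('a \<Rightarrow> real) set \<Rightarrow> 'a form \<Rightarrow> ('a \<Rightarrow> 'a cpath measure) \<Rightarrow> bool" where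
  "associated M D E P \<longleftrightarrow>
     (\<exists>T. form_semigroup M (closure_domain M D E) (closure_form M D E) T \<and>
        (\<forall>t>0. \<forall>f. square_integrable M f \<longrightarrow> bounded (range f) \<longrightarrow>
           (AE s in M. transition P t f s = T t f s)))"

definition reversible :: "'a::topological_space measure \<Rightarrow> ('a \<Rightarrow> 'a cpath measure) \<Rightarrow> bool" where
  "reversible M P \<longleftrightarrow> (\<forall>t\<ge>0. \<forall>f\<in>borel_measurable M. \<forall>g\<in>borel_measurable M.
     bounded (range f) \<longrightarrow> bounded (range g) \<longrightarrow>
     (\<integral>s. f s * transition P t g s \<partial>M) = (\<integral>s. transition P t f s * g s \<partial>M))"

text \<open>The labeled process, realised on the path space of the unlabeled diffusion \<open>P\<close>: for
  quasi-every starting point \<open>s\<close>, almost surely \<open>X\<^sup>i\<^sub>0 = l\<^sub>i(s)\<close> for all \<open>i\<close> and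
  \<open>w\<^sub>t = \<Sum>\<^sub>i \<delta>(X\<^sup>i\<^sub>t)\<close> for all \<open>t \<ge> 0\<close>. The argument \<open>cap\<close> is the capacity.\<close>

definition labeled_process ::
    "('n::finite config set \<Rightarrow> ennreal) \<Rightarrow> ('n config \<Rightarrow> 'n config cpath measure) \<Rightarrow>
       ('n config \<Rightarrow> int \<Rightarrow> real ^ 'n) \<Rightarrow> (int \<Rightarrow> 'n config cpath \<Rightarrow> (real ^ 'n) cpath) \<Rightarrow> bool" where
  "labeled_process cap P l X \<longleftrightarrow>
     (\<forall>i. X i \<in> borel \<rightarrow>\<^sub>M borel) \<and>
     (\<exists>N. cap N = 0 \<and> (\<forall>s\<in>S_si - N. AE w in P s.
        (\<forall>i. path_at (X i w) 0 = l s i) \<and>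
        (\<forall>t\<ge>0. \<forall>x. finite {i. path_at (X i w) t = x} \<and>
           card {i. path_at (X i w) t = x} = mult (path_at w t) x)))"


section \<open>Brownian motion and square roots of matrices\<close>

definition standard_Brownian_motion ::
    "'w measure \<Rightarrow> ('w \<Rightarrow> (real ^ 'n::finite) cpath) \<Rightarrow> bool" where
  "standard_Brownian_motion W B \<longleftrightarrow>
     prob_space W \<and> B \<in> W \<rightarrow>\<^sub>M borel \<and>
     (AE \<omega> in W. path_at (B \<omega>) 0 = 0) \<and>
     (\<forall>(m::nat) t. 0 \<le> t 0 \<longrightarrow> (\<forall>j<m. t j < t (Suc j)) \<longrightarrow>
        prob_space.indep_vars W (\<lambda>_. borel)
          (\<lambda>j \<omega>. path_at (B \<omega>) (t (Suc j)) - path_at (B \<omega>) (t j)) {..<m}) \<and>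
     (\<forall>r\<ge>0. \<forall>t>r. distributed W lborel (\<lambda>\<omega>. path_at (B \<omega>) t - path_at (B \<omega>) r)
        (\<lambda>x. ennreal (\<Prod>k\<in>UNIV. normal_density 0 (sqrt (t - r)) (x $ k))))"

definition nonneg_definite :: "real ^ 'n ^ 'n::finite \<Rightarrow> bool" where
  "nonneg_definite A \<longleftrightarrow> transpose A = A \<and> (\<forall>v. 0 \<le> v \<bullet> (A *v v))"

definition matrix_sqrt :: "real ^ 'n ^ 'n::finite \<Rightarrow> real ^ 'n ^ 'n" where
  "matrix_sqrt A = (THE R. nonneg_definite R \<and> R ** R = A)"


section \<open>The forms of the interacting particle system\<close>

definition E_mu :: "'n::finite config measure \<Rightarrow> 'n config form" where
  "E_mu \<mu> = energy \<mu> square_field"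

definition D_mu :: "'n::finite config measure \<Rightarrow> ('n config \<Rightarrow> real) set" where
  "D_mu \<mu> = energy_domain \<mu> square_field D_loc"

definition Cap :: "'n::finite config measure \<Rightarrow> 'n config set \<Rightarrow> ennreal" where
  "Cap \<mu> = capacity \<mu> (closure_domain \<mu> (D_mu \<mu>) (E_mu \<mu>)) (closure_form \<mu> (D_mu \<mu>) (E_mu \<mu>))"

definition E_one ::
    "(real ^ 'n \<Rightarrow> real) \<Rightarrow> 'n::finite config measure \<Rightarrow> ((real ^ 'n) \<times> 'n config) form" where
  "E_one \<rho>1 \<mu>\<^sub>0 = energy (one_campbell \<rho>1 \<mu>\<^sub>0) square_field_campbell"

definition D_one ::
    "(real ^ 'n \<Rightarrow> real) \<Rightarrow> 'n::finite config measure \<Rightarrow> ((real ^ 'n) \<times> 'n config \<Rightarrow> real) set" where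
  "D_one \<rho>1 \<mu>\<^sub>0 = energy_domain (one_campbell \<rho>1 \<mu>\<^sub>0) square_field_campbell tensor_loc"

definition E_XY :: "'n::finite config measure \<Rightarrow> ((real ^ 'n) \<times> 'n config) form" where
  "E_XY \<mu>\<^sub>0 = energy (lborel \<Otimes>\<^sub>M \<mu>\<^sub>0) square_field_tagged"

definition D_XY :: "'n::finite config measure \<Rightarrow> ((real ^ 'n) \<times> 'n config \<Rightarrow> real) set" where
  "D_XY \<mu>\<^sub>0 = energy_domain (lborel \<Otimes>\<^sub>M \<mu>\<^sub>0) square_field_tagged tensor_loc"

definition centered_path ::
    "('a::real_normed_vector \<times> 'b::topological_space) cpath \<Rightarrow> ('a \<times> 'b) cpath" where
  "centered_path w = map_path (\<lambda>(x, y). (x - fst (path_at w 0), y)) w"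

end

theory Submission
  imports Defs
begin

text \<open>Why the theorem holds. Fix the index \<open>i\<close> and write \<open>x = l\<^sub>i(s)\<close> and
  \<open>e = \<theta>\<^bsub>-x\<^esub>(s - \<delta>\<^sub>x)\<close>. For the fixed versions of the laws, \<open>X\<^sup>i\<close> under \<open>P s\<close> has the law of the
  tagged particle started from \<open>(x, e)\<close>, and the law of its displacement does not depend on \<open>x\<close>. So
  \<open>E\<^sub>s[F(\<epsilon> X\<^sup>i)]\<close> is the mean of \<open>F\<close> along the rescaled displacement of the tagged particle started from
  \<open>(0, e)\<close>, translated by \<open>\<epsilon> x\<close>. Two things separate this from the given invariance principle: the
  translation by \<open>\<epsilon> x\<close>, and the passage from \<open>\<mu>\<^sub>0\<close>-probability to \<open>\<mu>\<close>-probability.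

  The translation. A bounded continuous \<open>F\<close> need not be uniformly continuous, so it is compared with its
  translates through \<open>F\<^sub>\<delta>(w) = sup\<^bsub>|y|\<le>\<delta>\<^esub> |F(w + y) - F(w)|\<close>. This functional is again bounded and
  continuous, because the ball is compact and \<open>(w, y) \<mapsto> w + y\<close> is continuous for the compact-open
  topology. The invariance principle therefore applies to \<open>F\<^sub>\<delta>\<close> as well, and its Brownian limit
  \<open>E[F\<^sub>\<delta>(\<surd>a(e) B)]\<close> tends to \<open>0\<close> with \<open>\<delta>\<close> for each \<open>e\<close> by dominated convergence. Hence for \<open>|x| \<le> R\<close>
  the exceptional environments lie, for small \<open>\<epsilon>\<close>, in one set \<open>C\<^sub>\<epsilon>\<close> that is independent of \<open>x\<close> and has small
  \<open>\<mu>\<^sub>0\<close>-measure.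

  The change of measure. The reduced Palm measures disintegrate the reduced Campbell measure, and
  \<open>\<mu>\<^sub>x = \<mu>\<^sub>0 \<circ> \<theta>\<^sub>x\<^sup>-\<^sup>1\<close>. In coordinates seen from the particle this says
  \<open>\<integral> \<Sum>\<^bsub>x\<in>s\<^esub> 1\<^sub>A(x) 1\<^sub>C(e(s, x)) d\<mu> = \<mu>\<^sub>0(C) \<integral>\<^sub>A \<rho>\<^sup>1(x) dx\<close> (lemma \<open>Campbell_environment\<close>). With \<open>A\<close> a
  ball of radius \<open>R\<close> and local boundedness of \<open>\<rho>\<^sup>1\<close>, the set where \<open>|l\<^sub>i(s)| \<le> R\<close> and the environment is
  in \<open>C\<^sub>\<epsilon>\<close> has \<open>\<mu>\<close>-measure at most a constant times \<open>\<mu>\<^sub>0(C\<^sub>\<epsilon>)\<close>. The rest, \<open>|l\<^sub>i(s)| > R\<close>, has small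
  \<open>\<mu>\<close>-measure for large \<open>R\<close> because \<open>l\<^sub>i\<close> is finite.

  Most of the work is measurability. The measure of a set that is not measurable is \<open>0\<close> by convention, so
  the invariance principle has content only once its exceptional sets are known to be measurable; this
  needs measurability of the matrix square root, which follows from its uniqueness. The Campbell formula
  is given on rectangles \<open>A \<times> C\<close> but is needed on \<open>{(x, t). x \<in> A \<and> \<theta>\<^bsub>-x\<^esub> t \<in> C}\<close>, so the shift must be
  jointly measurable for the product \<open>\<sigma>\<close>-algebra. A map into the configurations is shown to be measurable
  as soon as its counts in bounded Borel sets are (lemma \<open>measurable_into_config\<close>): counts in finitely
  many cells of a fine grid separate a configuration from the complement of any of its neighbourhoods,
  and there are only countably many such families of counts.\<close>

section \<open>The compact-open topology on paths\<close>

lemma open_subbasic_cpath: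
  "compact K \<Longrightarrow> K \<subseteq> {0..} \<Longrightarrow> open U \<Longrightarrow> open {w. path_at w ` K \<subseteq> U}"
  unfolding open_cpath_def by (rule generate_topology.Basis) blast

lemma continuous_on_path_at: "continuous_on {0..} (path_at w)"
  using path_at[of w] by simp

lemma path_at_neg: "t < 0 \<Longrightarrow> path_at w t = path_at w 0"
  using path_at[of w] by simp

lemma path_at_map_path:
  assumes "continuous_on UNIV f"
  shows "path_at (map_path f w) t = f (path_at w t)"
proof -
  have "continuous_on {0..} (\<lambda>t. f (path_at w t))"
    by (rule continuous_on_compose2[OF assms continuous_on_path_at]) auto
  then show ?thesis
    unfolding map_path_def by (subst Abs_cpath_inverse) (auto simp: path_at_neg)
qed

lemma continuous_into_cpathI:
  fixes g :: "'b::topological_space \<Rightarrow> 'a::topological_space cpath"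
  assumes "\<And>K U. compact K \<Longrightarrow> K \<subseteq> {0..} \<Longrightarrow> open U \<Longrightarrow> open {x. path_at (g x) ` K \<subseteq> U}"
  shows "continuous_on UNIV g"
proof -
  have "open (g -` W)" if "open W" for W
  proof -
    have "generate_topology {{w. path_at w ` K \<subseteq> U} | K U. compact K \<and> K \<subseteq> {0..} \<and> open U} W"
      using that unfolding open_cpath_def .
    then show ?thesis
    proof induction
      case (Basis s)
      then show ?case using assms by (auto simp: vimage_def)
    next
      case (UN K)
      then show ?case by (simp add: vimage_Union open_UN)
    qed auto
  qed
  then show ?thesis by (simp add: continuous_on_open_vimage)
qed

text \<open>Continuity of a path makes it stay in one factor of a product box on a short compact time interval;
compactness of \<open>K\<close> reduces to finitely many such intervals. All joint continuity statements about
operations on paths that depend on a parameter (translation, centring, multiplication by a matrix)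
are instances of this one.\<close>

lemma open_paths_with_parameter:
  fixes V :: "('a::topological_space \<times> 'c::topological_space) set"
  assumes K: "compact K" "K \<subseteq> {0..}" and V: "open V"
  shows "open {(w, c). \<forall>t\<in>K. (path_at w t, c) \<in> V}"
proof (subst open_subopen, clarsimp)
  fix w0 :: "'a cpath" and c0 :: 'c
  assume w0: "\<forall>t\<in>K. (path_at w0 t, c0) \<in> V"
  have "\<exists>A B r. open A \<and> open B \<and> c0 \<in> B \<and> A \<times> B \<subseteq> V \<and> r > 0 \<and>
      path_at w0 ` (K \<inter> cball t r) \<subseteq> A" if t: "t \<in> K" for t
  proof -
    obtain A B where AB: "open A" "open B" "path_at w0 t \<in> A" "c0 \<in> B" "A \<times> B \<subseteq> V"
      using open_prod_elim[OF V, of "(path_at w0 t, c0)"] w0 t by (metis mem_Sigma_iff)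
    obtain T where T: "open T" "T \<inter> {0..} = path_at w0 -` A \<inter> {0..}"
      using continuous_on_path_at[of w0] AB(1) unfolding continuous_on_open_invariant by blast
    then have "t \<in> T" using AB(3) t K(2) by auto
    then obtain r where "r > 0" "cball t r \<subseteq> T"
      using T(1) open_contains_cball by blast
    then show ?thesis
      using AB T K(2) by (intro exI[of _ A] exI[of _ B] exI[of _ r]) blast
  qed
  then obtain A B r where ABr: "\<And>t. t \<in> K \<Longrightarrow> open (A t) \<and> open (B t) \<and> c0 \<in> B t \<and>
      A t \<times> B t \<subseteq> V \<and> r t > 0 \<and> path_at w0 ` (K \<inter> cball t (r t)) \<subseteq> A t"
    by metis
  have "K \<subseteq> (\<Union>t\<in>K. ball t (r t))" using ABr by force
  then obtain F where F: "F \<subseteq> K" "finite F" "K \<subseteq> (\<Union>t\<in>F. ball t (r t))"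
    using compactE_image[OF K(1), of K "\<lambda>t. ball t (r t)"] by auto
  define N where "N = (\<Inter>t\<in>F. {w. path_at w ` (K \<inter> cball t (r t)) \<subseteq> A t}) \<times> (\<Inter>t\<in>F. B t)"
  have "open N"
    unfolding N_def using F K ABr
    by (intro open_Times open_INT ballI open_subbasic_cpath compact_Int_closed) auto
  moreover have "(w0, c0) \<in> N"
    using ABr F unfolding N_def by auto
  moreover have "N \<subseteq> {(w, c). \<forall>t\<in>K. (path_at w t, c) \<in> V}"
  proof clarify
    fix w c t assume wc: "(w, c) \<in> N" and t: "t \<in> K"
    obtain u where u: "u \<in> F" "t \<in> ball u (r u)" using F(3) t by auto
    then have "t \<in> K \<inter> cball u (r u)" using t by auto
    then have "path_at w t \<in> A u" "c \<in> B u" using wc u(1) unfolding N_def by blast+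
    then show "(path_at w t, c) \<in> V" using ABr[of u] u(1) F(1) by blast
  qed
  ultimately show "\<exists>T. open T \<and> (w0, c0) \<in> T \<and>
      T \<subseteq> {(w, c). \<forall>t\<in>K. (path_at w t, c) \<in> V}" by blast
qed

lemma continuous_on_map_path_parameter:
  fixes f :: "'c::topological_space \<Rightarrow> 'a::topological_space \<Rightarrow> 'b::topological_space"
  assumes f: "continuous_on UNIV (\<lambda>(y, c). f c y)"
  shows "continuous_on UNIV (\<lambda>(w, c). map_path (f c) w)"
proof (rule continuous_into_cpathI)
  fix K :: "real set" and U :: "'b set"
  assume K: "compact K" "K \<subseteq> {0..}" "open U"
  have c: "continuous_on UNIV (f c)" for c
    using continuous_on_compose2[OF f, of UNIV "\<lambda>y. (y, c)"]
    by (simp add: continuous_on_Pair continuous_on_const continuous_on_id)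
  have "open ((\<lambda>(y, c). f c y) -` U)"
    using f K(3) by (simp add: continuous_on_open_vimage)
  from open_paths_with_parameter[OF K(1,2) this]
  show "open {p. path_at (case p of (w, c) \<Rightarrow> map_path (f c) w) ` K \<subseteq> U}"
    by (rule back_subst[where P = "open"]) (auto simp: path_at_map_path[OF c])
qed

lemma continuous_on_map_path:
  fixes f :: "'a::topological_space \<Rightarrow> 'b::topological_space"
  assumes f: "continuous_on UNIV f"
  shows "continuous_on UNIV (map_path f)"
proof (rule continuous_into_cpathI)
  fix K :: "real set" and U :: "'b set"
  assume K: "compact K" "K \<subseteq> {0..}" "open U"
  have "open (f -` U)" using f K(3) by (simp add: continuous_on_open_vimage)
  from open_subbasic_cpath[OF K(1,2) this]
  show "open {w. path_at (map_path f w) ` K \<subseteq> U}"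
    by (rule back_subst[where P = "open"]) (auto simp: path_at_map_path[OF f])
qed

lemma continuous_on_rescale: "continuous_on UNIV (rescale \<epsilon>)"
proof (rule continuous_into_cpathI)
  fix K :: "real set" and U :: "'a set"
  assume K: "compact K" "K \<subseteq> {0..}" "open U"
  have "open ((\<lambda>y. \<epsilon> *\<^sub>R y) -` U)"
    by (intro open_vimage K) (auto intro!: continuous_intros)
  moreover have "compact ((\<lambda>t. t * inverse (\<epsilon>\<^sup>2)) ` K)"
    by (intro compact_continuous_image K) (auto intro!: continuous_intros)
  moreover have "(\<lambda>t. t * inverse (\<epsilon>\<^sup>2)) ` K \<subseteq> {0..}" using K(2) by auto
  ultimately have "open {w. path_at w ` (\<lambda>t. t * inverse (\<epsilon>\<^sup>2)) ` K \<subseteq> (\<lambda>y. \<epsilon> *\<^sub>R y) -` U}"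
    by (intro open_subbasic_cpath)
  then show "open {w. path_at (rescale \<epsilon> w) ` K \<subseteq> U}"
    by (rule back_subst[where P = "open"]) (auto simp: rescale.rep_eq divide_inverse)
qed

lemma continuous_on_path_at_point:
  assumes "0 \<le> t" shows "continuous_on UNIV (\<lambda>w. path_at w t)"
proof -
  have "open ((\<lambda>w. path_at w t) -` U)" if "open U" for U :: "'a set"
    using open_subbasic_cpath[of "{t}" U] assms that by (simp add: vimage_def)
  then show ?thesis by (simp add: continuous_on_open_vimage)
qed

lemma continuous_on_centered_path:
  "continuous_on UNIV
     (centered_path :: ('a::real_normed_vector \<times> 'b::topological_space) cpath \<Rightarrow> _)"
proof -
  have "continuous_on UNIV (\<lambda>(y, c). (case y :: 'a \<times> 'b of (u, s) \<Rightarrow> (u - c, s)))"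
    by (auto simp: case_prod_beta intro!: continuous_intros)
  then have *: "continuous_on UNIV (\<lambda>(w :: ('a \<times> 'b) cpath, c). map_path (\<lambda>(u, s). (u - c, s)) w)"
    by (rule continuous_on_map_path_parameter)
  have "continuous_on UNIV (\<lambda>w :: ('a \<times> 'b) cpath. (w, fst (path_at w 0)))"
    by (intro continuous_intros continuous_on_path_at_point) auto
  from continuous_on_compose2[OF * this] show ?thesis
    by (simp add: centered_path_def[abs_def])
qed

lemma path_at_centered_path:
  fixes w :: "('a::real_normed_vector \<times> 'b::topological_space) cpath"
  shows "path_at (centered_path w) t = (fst (path_at w t) - fst (path_at w 0), snd (path_at w t))"
  unfolding centered_path_def
  by (subst path_at_map_path) (auto simp: case_prod_beta intro!: continuous_intros)

section \<open>The modulus of a path functional under translations\<close>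

definition translate_path :: "'a::real_normed_vector \<Rightarrow> 'a cpath \<Rightarrow> 'a cpath" where
  "translate_path y = map_path (\<lambda>z. z + y)"

lemma path_at_translate_path [simp]: "path_at (translate_path y w) t = path_at w t + y"
  unfolding translate_path_def by (subst path_at_map_path) (auto intro!: continuous_intros)

lemma translate_path_0 [simp]: "translate_path 0 w = w"
  by (simp add: path_at_inject[symmetric] fun_eq_iff)

lemma continuous_on_translate_path: "continuous_on UNIV (\<lambda>(w, y). translate_path y w)"
  unfolding translate_path_def
  by (rule continuous_on_map_path_parameter) (auto simp: case_prod_beta intro!: continuous_intros)

text \<open>A strict lower bound is witnessed by a single \<open>y\<close>; a strict upper bound is inherited by nearby \<open>x\<close>
through the tube lemma.\<close>

lemma continuous_on_SUP_compact:
  fixes g :: "'a::topological_space \<times> 'b::topological_space \<Rightarrow> real"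
  assumes g: "continuous_on UNIV g" and K: "compact K" "K \<noteq> {}"
  shows "continuous_on UNIV (\<lambda>x. SUP y\<in>K. g (x, y))"
proof -
  have gx: "continuous_on K (\<lambda>y. g (x, y))" for x
    by (rule continuous_on_compose2[OF g]) (auto intro!: continuous_intros)
  have bdd: "bdd_above ((\<lambda>y. g (x, y)) ` K)" for x
    by (intro bounded_imp_bdd_above compact_imp_bounded compact_continuous_image gx K)
  have "((\<lambda>x. SUP y\<in>K. g (x, y)) \<longlongrightarrow> (SUP y\<in>K. g (x0, y))) (at x0)" for x0
  proof (rule order_tendstoI)
    fix b assume "b < (SUP y\<in>K. g (x0, y))"
    then obtain y where y: "y \<in> K" "b < g (x0, y)"
      using less_cSUP_iff[OF K(2) bdd] by blast
    have "open {x. b < g (x, y)}"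
      by (intro open_Collect_less continuous_intros continuous_on_compose2[OF g]) auto
    then have "eventually (\<lambda>x. b < g (x, y)) (at x0)"
      using y(2) by (auto simp: eventually_at_topological intro!: exI[of _ "{x. b < g (x, y)}"])
    then show "eventually (\<lambda>x. b < (SUP y\<in>K. g (x, y))) (at x0)"
      by eventually_elim (use y bdd in \<open>auto simp: less_cSUP_iff[OF K(2)]\<close>)
  next
    fix b assume b: "(SUP y\<in>K. g (x0, y)) < b"
    have sup_less: "(SUP y\<in>K. g (x, y)) < b" if "\<forall>y\<in>K. g (x, y) < b" for x
    proof -
      obtain y where y: "y \<in> K" "\<forall>z\<in>K. g (x, z) \<le> g (x, y)"
        using continuous_attains_sup[OF K gx] by blast
      then have "(SUP y\<in>K. g (x, y)) \<le> g (x, y)" using K(2) by (intro cSUP_least) auto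
      then show ?thesis using that y(1) by force
    qed
    have "open {p. g p < b}" by (intro open_Collect_less g continuous_intros)
    moreover have "{x0} \<times> K \<subseteq> {p. g p < b}"
      using b bdd[of x0] by (auto intro: le_less_trans[OF cSUP_upper])
    ultimately obtain X0 where "x0 \<in> X0" "open X0" "X0 \<times> K \<subseteq> {p. g p < b}"
      using Elementary_Topology.tube_lemma[OF K(1)] by metis
    then show "eventually (\<lambda>x. (SUP y\<in>K. g (x, y)) < b) (at x0)"
      by (auto simp: eventually_at_topological intro!: exI[of _ X0] sup_less)
  qed
  then show ?thesis by (simp add: continuous_on_def)
qed

text \<open>Continuity of \<open>F\<close> on the path space is not uniform; this functional of the path measures how much
\<open>F\<close> changes under small translations and is itself a continuous test function.\<close>

definition translation_modulus ::
    "('a::euclidean_space cpath \<Rightarrow> real) \<Rightarrow> real \<Rightarrow> 'a cpath \<Rightarrow> real" where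
  "translation_modulus F \<delta> w = (SUP y\<in>cball 0 \<delta>. \<bar>F (translate_path y w) - F w\<bar>)"

context
  fixes F :: "'a::euclidean_space cpath \<Rightarrow> real" and C :: real
  assumes F: "continuous_on UNIV F" and C: "\<And>w. \<bar>F w\<bar> \<le> C"
begin

lemma continuous_on_translation_difference:
  "continuous_on UNIV (\<lambda>(w, y). \<bar>F (translate_path y w) - F w\<bar>)"
proof -
  have "continuous_on UNIV (\<lambda>p. F (case p of (w, y) \<Rightarrow> translate_path y w))"
    by (rule continuous_on_compose2[OF F continuous_on_translate_path]) auto
  moreover have "continuous_on UNIV (\<lambda>p :: 'a cpath \<times> 'a. F (fst p))"
    by (rule continuous_on_compose2[OF F]) (auto intro!: continuous_intros)
  ultimately show ?thesis
    by (auto simp: case_prod_beta intro!: continuous_intros)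
qed

lemma bdd_above_translation_difference:
  "bdd_above ((\<lambda>y. \<bar>F (translate_path y w) - F w\<bar>) ` S)"
proof (rule bdd_aboveI2)
  fix y show "\<bar>F (translate_path y w) - F w\<bar> \<le> 2 * C"
    using C[of w] C[of "translate_path y w"] by linarith
qed

lemma translation_modulus_upper:
  "norm y \<le> \<delta> \<Longrightarrow> \<bar>F (translate_path y w) - F w\<bar> \<le> translation_modulus F \<delta> w"
  unfolding translation_modulus_def
  by (intro cSUP_upper bdd_above_translation_difference) auto

lemma translation_modulus_nonneg: "0 \<le> \<delta> \<Longrightarrow> 0 \<le> translation_modulus F \<delta> w"
  using translation_modulus_upper[of 0 \<delta> w] by simp

lemma translation_modulus_le: "0 \<le> \<delta> \<Longrightarrow> translation_modulus F \<delta> w \<le> 2 * C"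
  unfolding translation_modulus_def
proof (rule cSUP_least)
  fix y show "\<bar>F (translate_path y w) - F w\<bar> \<le> 2 * C"
    using C[of w] C[of "translate_path y w"] by linarith
qed auto

lemma continuous_on_translation_modulus:
  "0 \<le> \<delta> \<Longrightarrow> continuous_on UNIV (translation_modulus F \<delta>)"
  using continuous_on_SUP_compact[OF continuous_on_translation_difference, of "cball 0 \<delta>"]
  by (auto simp: translation_modulus_def[abs_def])

lemma translation_modulus_tendsto_0:
  "(\<lambda>n. translation_modulus F (1 / real (Suc n)) w) \<longlonglongrightarrow> 0"
proof (rule LIMSEQ_I)
  fix r :: real assume r: "0 < r"
  have "continuous_on UNIV (\<lambda>y. \<bar>F (translate_path y w) - F w\<bar>)"
    using continuous_on_compose2[OF continuous_on_translation_difference, of UNIV "\<lambda>y. (w, y)"]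
    by (simp add: continuous_on_Pair continuous_on_const continuous_on_id)
  then have "continuous (at 0) (\<lambda>y. \<bar>F (translate_path y w) - F w\<bar>)"
    by (simp add: continuous_on_eq_continuous_at)
  then obtain d where d: "d > 0" "\<And>y. norm y < d \<Longrightarrow> \<bar>F (translate_path y w) - F w\<bar> < r / 2"
    unfolding continuous_at_eps_delta using half_gt_zero[OF r]
    by (simp only: translate_path_0) (fastforce simp: dist_norm simp del: less_divide_eq_numeral1)
  obtain N :: nat where N: "1 / real (Suc N) < d"
    using nat_approx_posE[OF d(1)] by blast
  have "norm (translation_modulus F (1 / real (Suc n)) w - 0) < r" if "n \<ge> N" for n
  proof -
    have "1 / real (Suc n) \<le> 1 / real (Suc N)" using that by (simp add: frac_le)
    then have "translation_modulus F (1 / real (Suc n)) w \<le> r / 2"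
      unfolding translation_modulus_def using N
      by (intro cSUP_least less_imp_le[OF d(2)]) auto
    then show ?thesis using r translation_modulus_nonneg[of "1 / real (Suc n)" w] by auto
  qed
  then show "\<exists>N. \<forall>n\<ge>N. norm (translation_modulus F (1 / real (Suc n)) w - 0) < r" by blast
qed

end

section \<open>Measurability of the square root of a matrix\<close>

lemma inner_symmetric_matrix:
  fixes A :: "real ^ 'n ^ 'n::finite"
  assumes "transpose A = A"
  shows "x \<bullet> (A *v y) = (A *v x) \<bullet> y"
proof -
  have "x v* A = A *v x" using vector_transpose_matrix[of x A] assms by simp
  then show ?thesis using dot_lmul_matrix[of x A y] by simp
qed

text \<open>If \<open>A u \<noteq> 0\<close>, moving from \<open>u\<close> a little in the direction \<open>- A u\<close> makes the quadratic form negative.\<close>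

lemma nonneg_definite_form_eq_0:
  fixes A :: "real ^ 'n ^ 'n::finite"
  assumes A: "nonneg_definite A" and u: "u \<bullet> (A *v u) = 0"
  shows "A *v u = 0"
proof -
  define z where "z = A *v u"
  have sym: "x \<bullet> (A *v y) = (A *v x) \<bullet> y" for x y
    using A unfolding nonneg_definite_def by (intro inner_symmetric_matrix) simp
  have pos: "0 \<le> 2 * t * (z \<bullet> z) + t\<^sup>2 * (z \<bullet> (A *v z))" for t :: real
  proof -
    have "0 \<le> (u + t *\<^sub>R z) \<bullet> (A *v (u + t *\<^sub>R z))"
      using A unfolding nonneg_definite_def by blast
    also have "\<dots> = u \<bullet> (A *v u) + 2 * t * (z \<bullet> z) + t\<^sup>2 * (z \<bullet> (A *v z))"
      by (simp add: matrix_vector_right_distrib matrix_vector_mult_scaleR inner_add_left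
          inner_add_right sym[of u z] z_def[symmetric] power2_eq_square algebra_simps inner_commute)
    finally show ?thesis using u by simp
  qed
  have "z \<bullet> z = 0"
  proof (rule ccontr)
    assume "z \<bullet> z \<noteq> 0"
    then have q: "z \<bullet> z > 0" using inner_ge_zero[of z] by linarith
    define b where "b = z \<bullet> (A *v z)"
    have b: "b \<ge> 0" using A unfolding nonneg_definite_def b_def by blast
    (* The form at u + t z is 2 t |z|^2 + t^2 b; for negative t it is negative once |t| b < 2 |z|^2.
       The summand 1 covers b = 0. *)
    define t where "t = - (z \<bullet> z) / (b + 1)"
    have t: "t < 0" "t * (b + 1) = - (z \<bullet> z)"
      unfolding t_def using q b by (auto simp: divide_neg_pos)
    have "2 * t * (z \<bullet> z) + t\<^sup>2 * b = t * (2 * (z \<bullet> z) + t * b)"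
      by (simp add: power2_eq_square algebra_simps)
    moreover have "2 * (z \<bullet> z) + t * b > 0"
      using t q unfolding distrib_left by linarith
    ultimately have "2 * t * (z \<bullet> z) + t\<^sup>2 * b < 0" using t(1) by (simp add: mult_neg_pos)
    then show False using pos[of t] unfolding b_def by simp
  qed
  then show ?thesis unfolding z_def by simp
qed

text \<open>With \<open>D = R - S\<close> one has \<open>R D + D S = R\<^sup>2 - S\<^sup>2 = 0\<close>. Multiplying by \<open>D\<close> and taking the trace gives
\<open>tr(D R D) + tr(D S D) = 0\<close> with nonnegative terms, so \<open>R D = S D = 0\<close> and \<open>D\<^sup>2 = 0\<close>.\<close>

lemma nonneg_definite_sqrt_unique:
  fixes R S :: "real ^ 'n ^ 'n::finite"
  assumes R: "nonneg_definite R" and S: "nonneg_definite S" and eq: "R ** R = S ** S"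
  shows "R = S"
proof -
  define D where "D = R - S"
  have DT: "transpose D = D"
    using R S unfolding D_def nonneg_definite_def by (simp add: transpose_def vec_eq_iff)
  define e where "e k = D *v axis k 1" for k :: 'n
  have tr: "trace (D ** A ** D) = (\<Sum>k\<in>UNIV. e k \<bullet> (A *v e k))" for A
  proof -
    have "e k \<bullet> (A *v e k) = (D ** A ** D) $ k $ k" for k
    proof -
      have "e k \<bullet> (A *v e k) = axis k 1 \<bullet> (D *v (A *v e k))"
        unfolding e_def by (rule inner_symmetric_matrix[OF DT, symmetric])
      also have "D *v (A *v e k) = (D ** A ** D) *v axis k 1"
        unfolding e_def by (simp only: matrix_vector_mul_assoc matrix_mul_assoc)
      finally show ?thesis
        by (simp add: inner_axis' matrix_vector_mult_basis column_def)
    qed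
    then show ?thesis by (simp add: trace_def)
  qed
  have "R ** D + D ** S = 0"
  proof -
    have "R ** D = R ** R - R ** S" "D ** S = R ** S - S ** S"
      unfolding D_def by (simp_all add: vec_eq_iff matrix_matrix_mult_def right_diff_distrib
          left_diff_distrib sum_subtractf)
    then show ?thesis using eq by simp
  qed
  then have "trace (D ** (R ** D + D ** S)) = 0" by (simp add: trace_def)
  then have "trace (D ** R ** D) + trace (D ** S ** D) = 0"
  proof -
    have "trace (D ** (R ** D + D ** S)) = trace (D ** (R ** D)) + trace (D ** (D ** S))"
      by (simp add: matrix_add_ldistrib trace_add)
    also have "trace (D ** (D ** S)) = trace (D ** S ** D)"
      by (rule trace_mul_sym)
    finally show ?thesis
      using \<open>trace (D ** (R ** D + D ** S)) = 0\<close> by (simp add: matrix_mul_assoc)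
  qed
  moreover have nn: "0 \<le> e k \<bullet> (A *v e k)" if "nonneg_definite A" for A k
    using that unfolding nonneg_definite_def by blast
  moreover have "0 \<le> trace (D ** R ** D)" "0 \<le> trace (D ** S ** D)"
    unfolding tr by (intro sum_nonneg nn R S)+
  ultimately have tr0: "trace (D ** R ** D) = 0" "trace (D ** S ** D) = 0" by linarith+
  have "e k \<bullet> (R *v e k) = 0" "e k \<bullet> (S *v e k) = 0" for k
    using tr0 unfolding tr
    by (simp_all only: sum_nonneg_eq_0_iff[OF finite_class.finite_UNIV nn[OF R]]
        sum_nonneg_eq_0_iff[OF finite_class.finite_UNIV nn[OF S]] UNIV_I ball_simps)
  then have "R *v e k = 0" "S *v e k = 0" for k
    using nonneg_definite_form_eq_0[OF R] nonneg_definite_form_eq_0[OF S] by blast+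
  then have "D *v e k = 0" for k
    unfolding D_def by (simp only: matrix_vector_mult_diff_rdistrib diff_self)
  then have "e k \<bullet> e k = 0" for k
    using inner_symmetric_matrix[OF DT, of "axis k 1" "e k"] unfolding e_def[symmetric]
    by (simp only: inner_zero_right)
  then have "D *v axis k 1 = 0" for k
    unfolding e_def[symmetric] by simp
  then have "D = 0"
    by (simp add: matrix_vector_mult_basis column_def vec_eq_iff)
  then show ?thesis unfolding D_def by simp
qed

lemma continuous_on_matrix_vector_mult:
  "continuous_on UNIV (\<lambda>(y, A). (A :: real ^ 'n ^ 'm::finite) *v (y :: real ^ 'n::finite))"
  unfolding matrix_vector_mult_def case_prod_beta
  by (intro continuous_intros)

lemma closed_nonneg_definite: "closed {R :: real ^ 'n ^ 'n::finite. nonneg_definite R}"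
proof -
  have mv: "continuous_on UNIV (\<lambda>R :: real ^ 'n ^ 'n. R *v v)" for v
    using continuous_on_compose2[OF continuous_on_matrix_vector_mult, of UNIV "\<lambda>R. (v, R)"]
    by (simp add: continuous_on_Pair continuous_on_const continuous_on_id)
  have "closed {R :: real ^ 'n ^ 'n. transpose R = R}"
    unfolding transpose_def by (intro closed_Collect_eq continuous_intros)
  moreover have "closed {R :: real ^ 'n ^ 'n. 0 \<le> v \<bullet> (R *v v)}" for v
    by (intro closed_Collect_le continuous_intros mv)
  then have "closed (\<Inter>v. {R :: real ^ 'n ^ 'n. 0 \<le> v \<bullet> (R *v v)})" by blast
  ultimately have "closed ({R. transpose R = R} \<inter> (\<Inter>v. {R :: real ^ 'n ^ 'n. 0 \<le> v \<bullet> (R *v v)}))"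
    by (rule closed_Int)
  then show ?thesis
    by (rule back_subst[where P = closed]) (auto simp: nonneg_definite_def)
qed

text \<open>By uniqueness the square root inverts the continuous map \<open>R \<mapsto> R\<^sup>2\<close> on the closed cone of nonnegative
definite matrices. Closed subsets of the cone are countable unions of compact ones, hence so are their
images, which are therefore Borel. Outside the image of the cone the description in
\<open>matrix_sqrt\<close> is unsatisfiable, so the function is constant there.\<close>

lemma borel_measurable_matrix_sqrt:
  "matrix_sqrt \<in> borel_measurable (borel :: (real ^ 'n ^ 'n::finite) measure)"
proof -
  let ?sq = "\<lambda>R :: real ^ 'n ^ 'n. R ** R"
  let ?P = "{R :: real ^ 'n ^ 'n. nonneg_definite R}"
  have cont: "continuous_on S ?sq" for S
    unfolding matrix_matrix_mult_def by (intro continuous_intros)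
  have image: "?sq ` (?P \<inter> C) \<in> sets borel" if "closed C" for C
  proof -
    have "?P \<inter> C = (\<Union>n::nat. ?P \<inter> C \<inter> cball 0 (real n))"
      using real_arch_simple by (auto simp: mem_cball)
    then have "?sq ` (?P \<inter> C) = (\<Union>n::nat. ?sq ` (?P \<inter> C \<inter> cball 0 (real n)))" by blast
    moreover have "closed (?sq ` (?P \<inter> C \<inter> cball 0 (real n)))" for n
      by (intro compact_imp_closed compact_continuous_image cont closed_Int_compact closed_Int
          closed_nonneg_definite that compact_cball)
    ultimately show ?thesis by (auto intro!: borel_closed)
  qed
  have sqrt: "matrix_sqrt (R ** R) = R" if "nonneg_definite R" for R :: "real ^ 'n ^ 'n"
    unfolding matrix_sqrt_def using that
    by (intro the_equality) (auto intro: nonneg_definite_sqrt_unique)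
  have no_sqrt: "matrix_sqrt A = The (\<lambda>_. False)" if "A \<notin> ?sq ` ?P" for A
  proof -
    have "(\<lambda>R. nonneg_definite R \<and> R ** R = A) = (\<lambda>_. False)" using that by auto
    then show ?thesis unfolding matrix_sqrt_def by simp
  qed
  have "matrix_sqrt -` C \<in> sets borel" if C: "closed C" for C :: "(real ^ 'n ^ 'n) set"
  proof -
    have "matrix_sqrt -` C = ?sq ` (?P \<inter> C) \<union>
        (if The (\<lambda>_. False) \<in> C then - (?sq ` (?P \<inter> UNIV)) else {})"
    proof (intro set_eqI)
      fix A
      show "A \<in> matrix_sqrt -` C \<longleftrightarrow> A \<in> ?sq ` (?P \<inter> C) \<union>
        (if The (\<lambda>_. False) \<in> C then - (?sq ` (?P \<inter> UNIV)) else {})"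
      proof (cases "A \<in> ?sq ` ?P")
        case True
        then obtain R where R: "nonneg_definite R" "A = R ** R" by auto
        have "A \<in> ?sq ` (?P \<inter> C) \<longleftrightarrow> R \<in> C"
        proof
          assume "A \<in> ?sq ` (?P \<inter> C)"
          then obtain S where S: "nonneg_definite S" "S \<in> C" "A = S ** S" by blast
          have "R = S"
            by (rule nonneg_definite_sqrt_unique[OF R(1) S(1)]) (simp only: R(2)[symmetric] S(3)[symmetric])
          then show "R \<in> C" using S(2) by simp
        next
          assume "R \<in> C"
          then show "A \<in> ?sq ` (?P \<inter> C)" using R by blast
        qed
        with True show ?thesis using sqrt[OF R(1)] R(2) by simp
      next
        case False
        then have "A \<notin> ?sq ` (?P \<inter> C)" by blast
        with False no_sqrt[OF False] show ?thesis by simp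
      qed
    qed
    then show ?thesis using image[OF C] image[OF closed_UNIV] by auto
  qed
  then have "matrix_sqrt -` (- C) \<in> sets borel" if "closed C" for C :: "(real ^ 'n ^ 'n) set"
    using that by (auto simp: vimage_Compl)
  then have "matrix_sqrt -` U \<in> sets borel" if "open U" for U :: "(real ^ 'n ^ 'n) set"
    using that by (metis closed_Compl double_complement)
  then show ?thesis by (intro borel_measurableI) auto
qed

section \<open>Sums over the points of a configuration\<close>

text \<open>The integral of \<open>f\<close> against the point measure \<open>s\<close>. It is written over the counting measure
to match the Campbell formula in the definition of the reduced Palm measures.\<close>

definition config_sum :: "'n::finite config \<Rightarrow> (real ^ 'n \<Rightarrow> ennreal) \<Rightarrow> ennreal" where
  "config_sum s f = (\<integral>\<^sup>+y. of_nat (mult s y) * f y \<partial>count_space UNIV)"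

lemma finite_config_bounded:
  assumes "bounded A" shows "finite {x. x \<in> A \<and> mult s x \<noteq> 0}"
proof -
  obtain r where r: "\<And>x. x \<in> A \<Longrightarrow> norm x \<le> r" using assms bounded_iff by metis
  obtain m :: nat where "r \<le> m" using real_arch_simple by blast
  then have "{x. x \<in> A \<and> mult s x \<noteq> 0} \<subseteq> {x. norm x \<le> real m \<and> mult s x \<noteq> 0}"
    using r by fastforce
  moreover have "finite {x. norm x \<le> real m \<and> mult s x \<noteq> 0}" using mult[of s] by simp
  ultimately show ?thesis by (rule finite_subset)
qed

lemma config_sum_indicator:
  assumes "bounded A" shows "config_sum s (indicator A) = of_nat (config_count s A)"
proof -
  have "config_sum s (indicator A) =
      (\<Sum>x | x \<in> A \<and> mult s x \<noteq> 0. of_nat (mult s x) * indicator A x)"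
    unfolding config_sum_def
    by (rule nn_integral_count_space') (use finite_config_bounded[OF assms, of s] in \<open>auto simp: indicator_def\<close>)
  then show ?thesis by (simp add: config_count_def)
qed

lemma config_sum_finite:
  assumes "bounded A" "\<And>x. f x \<le> indicator A x" shows "config_sum s f < \<top>"
proof -
  have "config_sum s f \<le> config_sum s (indicator A)"
    unfolding config_sum_def by (intro nn_integral_mono mult_left_mono assms) auto
  also have "\<dots> < \<top>"
    by (simp add: config_sum_indicator[OF assms(1)] of_nat_less_top)
  finally show ?thesis .
qed

lemma config_sum_add: "config_sum s (\<lambda>y. f y + g y) = config_sum s f + config_sum s g"
  unfolding config_sum_def by (simp add: distrib_left nn_integral_add)

lemma config_sum_suminf: "config_sum s (\<lambda>y. \<Sum>i::nat. f i y) = (\<Sum>i. config_sum s (f i))"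
  unfolding config_sum_def by (simp add: nn_integral_suminf[symmetric])

lemma config_sum_cmult: "config_sum s (\<lambda>y. c * f y) = c * config_sum s f"
  unfolding config_sum_def by (simp add: nn_integral_cmult[symmetric] mult_ac)

lemma config_sum_SUP:
  assumes "incseq f" shows "config_sum s (\<lambda>y. SUP i::nat. f i y) = (SUP i. config_sum s (f i))"
proof -
  have "config_sum s (\<lambda>y. SUP i::nat. f i y) =
      (\<integral>\<^sup>+y. (SUP i. of_nat (mult s y) * f i y) \<partial>count_space UNIV)"
    unfolding config_sum_def by (simp add: SUP_mult_left_ennreal)
  also have "\<dots> = (SUP i. config_sum s (f i))"
    unfolding config_sum_def
    by (rule nn_integral_monotone_convergence_SUP)
       (use assms in \<open>auto simp: incseq_def le_fun_def intro!: mult_left_mono\<close>)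
  finally show ?thesis .
qed

lemma config_sum_eq_config_integral:
  assumes \<phi>: "\<And>x. 0 \<le> \<phi> x" "\<And>x. x \<notin> A \<Longrightarrow> \<phi> x = 0" and A: "bounded A"
  shows "config_sum s (\<lambda>y. ennreal (\<phi> y)) = ennreal (config_integral s \<phi>)"
proof -
  have "config_sum s (\<lambda>y. ennreal (\<phi> y)) =
      (\<Sum>x | mult s x \<noteq> 0 \<and> \<phi> x \<noteq> 0. of_nat (mult s x) * ennreal (\<phi> x))"
    unfolding config_sum_def
  proof (rule nn_integral_count_space')
    show "finite {x. mult s x \<noteq> 0 \<and> \<phi> x \<noteq> 0}"
      by (rule finite_subset[OF _ finite_config_bounded[OF A, of s]]) (use \<phi> in auto)
  qed auto
  also have "\<dots> = ennreal (config_integral s \<phi>)"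
    unfolding config_integral_def
    by (simp add: sum_ennreal[symmetric] \<phi>(1) ennreal_mult ennreal_of_nat_eq_real_of_nat)
  finally show ?thesis .
qed

lemma continuous_on_config_integral:
  assumes "continuous_on UNIV \<phi>" "compact (closure {x. \<phi> x \<noteq> 0})"
  shows "continuous_on UNIV (\<lambda>s. config_integral s \<phi>)"
proof -
  have "open ((\<lambda>s. config_integral s \<phi>) -` U)" if "open U" for U
    unfolding open_config_def
    by (rule generate_topology.Basis) (use assms that in \<open>auto simp: vimage_def\<close>)
  then show ?thesis by (simp add: continuous_on_open_vimage)
qed

text \<open>The vague topology makes sums of continuous compactly supported functions continuous; the indicator of a
bounded open set is an increasing limit of such functions.\<close>

lemma borel_measurable_config_sum_open:
  assumes G: "open G" "bounded G"
  shows "(\<lambda>s :: 'n::finite config. config_sum s (indicator G)) \<in> borel_measurable borel"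
proof -
  have ne: "- G \<noteq> {}"
    using G(2) not_bounded_UNIV by (metis Compl_empty_eq double_complement)
  define \<phi> where "\<phi> j x = min 1 (real j * infdist x (- G))" for j :: nat and x :: "real ^ 'n"
  have zero: "\<phi> j x = 0" if "x \<notin> G" for j x using that by (simp add: \<phi>_def)
  have nonneg: "0 \<le> \<phi> j x" for j x by (simp add: \<phi>_def infdist_nonneg)
  have "compact (closure {x. \<phi> j x \<noteq> 0})" for j
    unfolding compact_closure by (rule bounded_subset[OF G(2)]) (use zero in auto)
  moreover have "continuous_on UNIV (\<phi> j)" for j
    unfolding \<phi>_def by (intro continuous_intros)
  ultimately have meas: "(\<lambda>s. config_sum s (\<lambda>x. ennreal (\<phi> j x))) \<in> borel_measurable borel" for j
  proof -
    assume "\<And>j. compact (closure {x. \<phi> j x \<noteq> 0})" "\<And>j. continuous_on UNIV (\<phi> j)"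
    then have "(\<lambda>s. config_integral s (\<phi> j)) \<in> borel_measurable borel"
      by (intro borel_measurable_continuous_onI continuous_on_config_integral)
    moreover have "config_sum s (\<lambda>x. ennreal (\<phi> j x)) = ennreal (config_integral s (\<phi> j))" for s
      by (rule config_sum_eq_config_integral[OF nonneg zero G(2)])
    ultimately show ?thesis by simp
  qed
  have inc: "incseq (\<lambda>j x. ennreal (\<phi> j x))"
    unfolding incseq_def le_fun_def \<phi>_def
    by (intro allI impI ennreal_leI min.mono mult_right_mono) (auto simp: infdist_nonneg)
  have "(SUP j. ennreal (\<phi> j x)) = indicator G x" for x
  proof (cases "x \<in> G")
    case True
    then have "infdist x (- G) > 0"
      using G(1) ne by (simp add: infdist_pos_not_in_closed closed_Compl)
    then obtain j :: nat where "1 \<le> real j * infdist x (- G)"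
      using reals_Archimedean3[of "infdist x (- G)"] by (metis less_imp_le)
    then have "\<phi> j x = 1" by (simp add: \<phi>_def)
    then have "1 \<le> (SUP j. ennreal (\<phi> j x))" by (intro SUP_upper2[of j]) auto
    moreover have "(SUP j. ennreal (\<phi> j x)) \<le> 1"
      by (intro SUP_least) (simp add: \<phi>_def)
    ultimately show ?thesis using True by simp
  qed (simp add: zero)
  then have "config_sum s (indicator G) = (SUP j. config_sum s (\<lambda>x. ennreal (\<phi> j x)))" for s
    using config_sum_SUP[OF inc, of s] by simp
  then show ?thesis using meas by simp
qed

text \<open>Extends the open case by Dynkin's lemma; the intersection with a ball keeps the counts finite, so that
complements can be handled by subtraction.\<close>

lemma borel_measurable_config_sum_ball:
  assumes "A \<in> sets borel"
  shows "(\<lambda>s :: 'n::finite config. config_sum s (indicator (A \<inter> ball 0 r))) \<in> borel_measurable borel"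
proof -
  have "A \<in> sigma_sets UNIV {S. open S}"
    using assms by (simp add: borel_def)
  have stable: "Int_stable {S :: (real ^ 'n) set. open S}" "{S :: (real ^ 'n) set. open S} \<subseteq> Pow UNIV"
    by (auto simp: Int_stable_def)
  from stable \<open>A \<in> sigma_sets UNIV {S. open S}\<close> show ?thesis
  proof (induction rule: sigma_sets_induct_disjoint)
    case (basic A)
    then show ?case by (intro borel_measurable_config_sum_open) auto
  next
    case empty
    then show ?case by (simp add: config_sum_def)
  next
    case (compl A)
    have "config_sum s (indicator ((UNIV - A) \<inter> ball 0 r)) =
        config_sum s (indicator (ball 0 r)) - config_sum s (indicator (A \<inter> ball 0 r))"
      for s :: "'n config"
    proof -
      have "config_sum s (indicator (ball 0 r)) =
          config_sum s (\<lambda>y. indicator ((UNIV - A) \<inter> ball 0 r) y + indicator (A \<inter> ball 0 r) y)"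
        by (rule arg_cong[where f = "config_sum s"]) (auto simp: indicator_def)
      also have "\<dots> = config_sum s (indicator ((UNIV - A) \<inter> ball 0 r)) +
          config_sum s (indicator (A \<inter> ball 0 r))" by (rule config_sum_add)
      finally show ?thesis
        by (simp add: config_sum_indicator bounded_Int)
    qed
    moreover have "(\<lambda>s :: 'n config. config_sum s (indicator (ball 0 r))) \<in> borel_measurable borel"
      by (intro borel_measurable_config_sum_open) auto
    ultimately show ?case using compl by simp
  next
    case (union A)
    have "config_sum s (indicator ((\<Union>i. A i) \<inter> ball 0 r)) =
        (\<Sum>i. config_sum s (indicator (A i \<inter> ball 0 r)))" for s :: "'n config"
    proof -
      have "(\<Sum>i. indicator (A i \<inter> ball 0 r) y) = (indicator (\<Union>i. A i \<inter> ball 0 r) y :: ennreal)" for y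
        by (rule suminf_indicator) (use union in \<open>auto simp: disjoint_family_on_def\<close>)
      then show ?thesis by (simp add: config_sum_suminf[symmetric] Int_UN_distrib2)
    qed
    then show ?case using union by simp
  qed
qed

text \<open>A configuration that depends measurably on a parameter acts as a locally finite kernel: sums over its
points of jointly measurable functions are measurable in the parameter. The proof treats rectangles, then
all measurable sets within a ball by Dynkin's lemma, and lets the ball grow.\<close>

lemma borel_measurable_config_sum_indicator:
  assumes \<sigma>: "\<sigma> \<in> N \<rightarrow>\<^sub>M (borel :: 'n::finite config measure)"
    and E: "E \<in> sets (N \<Otimes>\<^sub>M borel)"
  shows "(\<lambda>p. config_sum (\<sigma> p) (\<lambda>y. indicator E (p, y))) \<in> borel_measurable N"
proof -
  have ball: "(\<lambda>p. config_sum (\<sigma> p) (\<lambda>y. indicator (E \<inter> UNIV \<times> ball 0 r) (p, y))) \<in> borel_measurable N"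
    (is "?f E \<in> _") for r
  proof -
    have rectangles: "{A \<times> B | A B. A \<in> sets N \<and> B \<in> sets borel} \<subseteq> Pow (space N \<times> UNIV)"
      using sets.sets_into_space by fastforce
    have "E \<in> sigma_sets (space N \<times> UNIV) {A \<times> B | A B. A \<in> sets N \<and> B \<in> sets borel}"
      using E by (simp add: sets_pair_measure)
    from Int_stable_pair_measure_generator rectangles this show ?thesis
    proof (induction rule: sigma_sets_induct_disjoint)
      case (basic E)
      then obtain A B where AB: "E = A \<times> B" "A \<in> sets N" "B \<in> sets borel" by blast
      have eq: "?f E = (\<lambda>p. indicator A p * config_sum (\<sigma> p) (indicator (B \<inter> ball 0 r)))"
        by (auto simp: fun_eq_iff AB(1) config_sum_cmult[symmetric] indicator_def config_sum_def
            intro!: nn_integral_cong)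
      show ?case
        unfolding eq
        by (intro borel_measurable_times_ennreal borel_measurable_indicator AB(2)
            measurable_compose[OF \<sigma> borel_measurable_config_sum_ball[OF AB(3)]])
    next
      case empty
      then show ?case by (simp add: config_sum_def)
    next
      case (compl E)
      have "?f (space N \<times> UNIV - E) p = config_sum (\<sigma> p) (indicator (UNIV \<inter> ball 0 r)) - ?f E p"
        if "p \<in> space N" for p
      proof -
        have "config_sum (\<sigma> p) (indicator (UNIV \<inter> ball 0 r)) =
            config_sum (\<sigma> p) (\<lambda>y. indicator ((space N \<times> UNIV - E) \<inter> UNIV \<times> ball 0 r) (p, y) +
              indicator (E \<inter> UNIV \<times> ball 0 r) (p, y))"
          by (rule arg_cong[where f = "config_sum (\<sigma> p)"])
             (use that in \<open>auto simp: indicator_def fun_eq_iff\<close>)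
        also have "\<dots> = ?f (space N \<times> UNIV - E) p + ?f E p" by (rule config_sum_add)
        finally have "config_sum (\<sigma> p) (indicator (UNIV \<inter> ball 0 r)) = \<dots>" .
        moreover have "?f E p < \<top>"
          by (rule config_sum_finite[of "ball 0 r"]) (auto simp: indicator_def)
        ultimately show ?thesis by simp
      qed
      moreover have "(\<lambda>p. config_sum (\<sigma> p) (indicator (UNIV \<inter> ball 0 r)) - ?f E p) \<in> borel_measurable N"
        by (intro borel_measurable_minus_ennreal compl
            measurable_compose[OF \<sigma> borel_measurable_config_sum_ball]) auto
      ultimately show ?case by (subst measurable_cong) auto
    next
      case (union A)
      have "?f (\<Union>i. A i) p = (\<Sum>i. ?f (A i) p)" for p
      proof -
        have "(\<Sum>i. indicator (A i \<inter> UNIV \<times> ball 0 r) (p, y)) =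
            (indicator (\<Union>i. A i \<inter> UNIV \<times> ball 0 r) (p, y) :: ennreal)" for y
          by (rule suminf_indicator) (use union in \<open>auto simp: disjoint_family_on_def\<close>)
        then show ?thesis by (simp add: config_sum_suminf[symmetric] Int_UN_distrib2)
      qed
      then show ?case using union by simp
    qed
  qed
  have inc: "incseq (\<lambda>i y. indicator (E \<inter> UNIV \<times> ball 0 (real i)) (p, y) :: ennreal)" for p
    by (auto simp: incseq_def le_fun_def indicator_def)
  have "(SUP i. indicator (E \<inter> UNIV \<times> ball 0 (real i)) (p, y)) = (indicator E (p, y) :: ennreal)" for p y
  proof -
    obtain i :: nat where i: "norm y < real i" using reals_Archimedean2 by blast
    show ?thesis
      by (rule antisym, rule SUP_least, simp add: indicator_def, rule SUP_upper2[of i])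
         (use i in \<open>auto simp: indicator_def\<close>)
  qed
  then have "config_sum (\<sigma> p) (\<lambda>y. indicator E (p, y)) =
      (SUP i. config_sum (\<sigma> p) (\<lambda>y. indicator (E \<inter> UNIV \<times> ball 0 (real i)) (p, y)))" for p
    using config_sum_SUP[OF inc, of "\<sigma> p" p] by simp
  then show ?thesis using ball by simp
qed

section \<open>Borel sets of configurations are determined by counts in small cells\<close>

text \<open>The index of the half-open cube of side \<open>1 / (m + 1)\<close> that contains \<open>x\<close>.\<close>

definition cell :: "nat \<Rightarrow> real ^ 'n::finite \<Rightarrow> 'n \<Rightarrow> int" where
  "cell m x = (\<lambda>k. \<lfloor>real (Suc m) * x $ k\<rfloor>)"

lemma cell_eq_dist:
  fixes x y :: "real ^ 'n::finite"
  assumes "cell m x = cell m y" shows "dist x y \<le> CARD('n) / Suc m"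
proof -
  have "\<bar>(x - y) $ k\<bar> \<le> 1 / Suc m" for k
  proof -
    have "\<lfloor>real (Suc m) * x $ k\<rfloor> = \<lfloor>real (Suc m) * y $ k\<rfloor>"
      using fun_cong[OF assms, of k] unfolding cell_def .
    then have "\<bar>real (Suc m) * x $ k - real (Suc m) * y $ k\<bar> < 1" by linarith
    moreover have "\<bar>real (Suc m) * x $ k - real (Suc m) * y $ k\<bar> = real (Suc m) * \<bar>x $ k - y $ k\<bar>"
      unfolding right_diff_distrib[symmetric] abs_mult by simp
    ultimately show ?thesis
      by (simp add: pos_le_divide_eq mult.commute del: of_nat_Suc)
  qed
  then have "(\<Sum>k\<in>UNIV. \<bar>(x - y) $ k\<bar>) \<le> (\<Sum>k::'n\<in>UNIV. 1 / Suc m)" by (intro sum_mono)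
  then show ?thesis using norm_le_l1_cart[of "x - y"] by (simp add: dist_norm)
qed

lemma finite_cell_box: "finite {z :: 'n::finite \<Rightarrow> int. \<forall>k. \<bar>z k\<bar> \<le> n}"
proof -
  have "{z :: 'n \<Rightarrow> int. \<forall>k. \<bar>z k\<bar> \<le> n} = (\<Pi>\<^sub>E k\<in>UNIV. {-n..n})"
    by (auto simp: PiE_UNIV_domain Pi_def abs_le_iff minus_le_iff)
  then show ?thesis by (simp add: finite_PiE)
qed

lemma cell_box:
  assumes "norm x \<le> r" "real (Suc m) * r + 1 \<le> real_of_int n" shows "\<bar>cell m x k\<bar> \<le> n"
proof -
  have "\<bar>x $ k\<bar> \<le> r" using component_le_norm_cart[of x k] assms(1) by linarith
  then have "\<bar>real (Suc m) * x $ k\<bar> \<le> real (Suc m) * r"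
    by (simp add: abs_mult del: of_nat_Suc)
  then show ?thesis using assms(2) unfolding cell_def by linarith
qed

lemma bounded_cell: "bounded {x :: real ^ 'n::finite. cell m x = z}"
proof (cases "\<exists>y :: real ^ 'n. cell m y = z")
  case True
  then obtain y :: "real ^ 'n" where y: "cell m y = z" by blast
  then have "{x. cell m x = z} \<subseteq> cball y (CARD('n) / Suc m)"
    using cell_eq_dist[of m y] by auto
  then show ?thesis by (rule bounded_subset[OF bounded_cball])
qed auto

lemma sets_cell: "{x :: real ^ 'n::finite. cell m x = z} \<in> sets borel"
proof -
  have "{x :: real ^ 'n. cell m x = z} = (\<Inter>k. {x. \<lfloor>real (Suc m) * x $ k\<rfloor> = z k})"
    by (auto simp: cell_def fun_eq_iff)
  moreover have "{x :: real ^ 'n. \<lfloor>real (Suc m) * x $ k\<rfloor> = z k} \<in> sets borel" for k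
  proof -
    have "(\<lambda>x :: real ^ 'n. \<lfloor>real (Suc m) * x $ k\<rfloor>) \<in> borel \<rightarrow>\<^sub>M count_space UNIV"
      by measurable
    from measurable_sets[OF this, of "{z k}"] show ?thesis by (simp add: vimage_def)
  qed
  ultimately show ?thesis by auto
qed

text \<open>The finite table of counts of \<open>s\<close> in all cells with bounded index, for the first \<open>n + 1\<close> grids. Keeping
the coarser grids makes each table determine all earlier ones, although the grids are not nested.\<close>

definition cell_pattern :: "nat \<Rightarrow> 'n::finite config \<Rightarrow> nat \<times> ('n \<Rightarrow> int) \<Rightarrow> nat" where
  "cell_pattern n s = (\<lambda>(m, z)\<in>{..n} \<times> {z. \<forall>k. \<bar>z k\<bar> \<le> int n}. config_count s {x. cell m x = z})"

lemma cell_pattern_mono: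
  assumes "n \<le> n'" "cell_pattern n' t = cell_pattern n' s"
  shows "cell_pattern n t = cell_pattern n s"
proof (rule ext, clarify)
  fix m z
  show "cell_pattern n t (m, z) = cell_pattern n s (m, z)"
  proof (cases "(m, z) \<in> {..n} \<times> {z. \<forall>k. \<bar>z k\<bar> \<le> int n}")
    case True
    then have z: "\<bar>z k\<bar> \<le> int n" for k by simp
    have "int n \<le> int n'" using assms(1) by simp
    note order_trans[OF z this]
    then have "(m, z) \<in> {..n'} \<times> {z. \<forall>k. \<bar>z k\<bar> \<le> int n'}"
      using True assms(1) by simp
    then show ?thesis using True fun_cong[OF assms(2), of "(m, z)"] by (simp add: cell_pattern_def)
  next
    case False
    then show ?thesis by (simp only: cell_pattern_def restrict_apply if_False)
  qed
qed

text \<open>The function \<open>\<phi>\<close> varies by less than \<open>\<eta>\<close> on each cell of a fine grid, so its sum over a configuration is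
determined by the cell counts up to \<open>\<eta>\<close> times the number of points near the support of \<open>\<phi>\<close>. That
number is read off from the counts as well, so it can be bounded by its value for \<open>s\<close>.\<close>

lemma cell_pattern_approximates:
  fixes s :: "'n::finite config"
  assumes \<phi>: "continuous_on UNIV \<phi>" "compact (closure {x. \<phi> x \<noteq> 0})"
    and U: "open U" "config_integral s \<phi> \<in> U"
  shows "\<exists>n. \<forall>t. cell_pattern n t = cell_pattern n s \<longrightarrow> config_integral t \<phi> \<in> U"
proof -
  obtain e where e: "e > 0" "ball (config_integral s \<phi>) e \<subseteq> U"
    using U open_contains_ball by blast
  have "bounded {x. \<phi> x \<noteq> 0}" using \<phi>(2) by (simp add: compact_closure)
  then obtain r where r: "r > 0" "\<And>x. \<phi> x \<noteq> 0 \<Longrightarrow> norm x \<le> r"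
    unfolding bounded_pos by blast
  (* Cells that meet the ball of radius r around the origin have diameter at most CARD('n) and lie in K. *)
  define K :: "(real ^ 'n) set" where "K = cball 0 (r + real CARD('n))"
  define M where "M = real (config_count s K)"
  (* Both configurations contribute an error \<eta> N with N \<le> M, and 2 \<eta> M < e. *)
  define \<eta> where "\<eta> = e / (2 * (M + 1))"
  have M: "M \<ge> 0" by (simp add: M_def)
  then have \<eta>: "\<eta> > 0" using e(1) by (simp add: \<eta>_def)
  have "uniformly_continuous_on K \<phi>"
    unfolding K_def
    by (intro compact_uniformly_continuous continuous_on_subset[OF \<phi>(1)]) auto
  then obtain \<delta> where \<delta>: "\<delta> > 0" "\<And>x y. x \<in> K \<Longrightarrow> y \<in> K \<Longrightarrow> dist y x < \<delta> \<Longrightarrow> dist (\<phi> y) (\<phi> x) < \<eta>"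
    unfolding uniformly_continuous_on_def using \<eta> by blast
  obtain m :: nat where m: "real CARD('n) / \<delta> < real m" using reals_Archimedean2 by blast
  then have "real CARD('n) < real (Suc m) * \<delta>"
    using \<delta>(1) by (simp add: pos_divide_less_eq algebra_simps)
  then have m\<delta>: "real CARD('n) / real (Suc m) < \<delta>"
    by (simp add: pos_divide_less_eq mult.commute del: of_nat_Suc)
  have m1: "real CARD('n) / real (Suc m) \<le> real CARD('n)"
    by (simp add: pos_divide_le_eq)
  define Z where "Z = cell m ` cball (0 :: real ^ 'n) r"
  define y where "y = inv_into (cball (0 :: real ^ 'n) r) (cell m)"
  have y: "y z \<in> cball 0 r" "cell m (y z) = z" if "z \<in> Z" for z
    using inv_into_into[OF that[unfolded Z_def]] f_inv_into_f[OF that[unfolded Z_def]]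
    by (simp_all only: y_def)
  have near: "x \<in> K" "\<bar>\<phi> x - \<phi> (y (cell m x))\<bar> \<le> \<eta>" if "cell m x \<in> Z" for x
  proof -
    have d: "dist x (y (cell m x)) \<le> real CARD('n) / real (Suc m)"
      using y(2)[OF that] by (intro cell_eq_dist) simp
    have "norm x \<le> norm (y (cell m x)) + dist x (y (cell m x))"
      unfolding dist_norm by (rule norm_triangle_sub)
    then show "x \<in> K" using y(1)[OF that] d m1 by (simp add: K_def)
    moreover have "y (cell m x) \<in> K" using y(1)[OF that] by (simp add: K_def)
    ultimately show "\<bar>\<phi> x - \<phi> (y (cell m x))\<bar> \<le> \<eta>"
      using \<delta>(2)[of "y (cell m x)" x] d m\<delta> by (simp add: dist_real_def)
  qed
  (* Large enough for the m-th grid and all of its cells that meet the ball to be in the table. *)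
  define n where "n = max m (nat \<lceil>real (Suc m) * r + 1\<rceil>)"
  have "real (Suc m) * r + 1 \<le> real (nat \<lceil>real (Suc m) * r + 1\<rceil>)" by (rule real_nat_ceiling_ge)
  also have "\<dots> \<le> real n" unfolding n_def by (simp only: of_nat_le_iff max.cobounded2)
  finally have n: "m \<le> n" "real (Suc m) * r + 1 \<le> real_of_int (int n)"
    by (simp_all only: n_def max.cobounded1 of_int_of_nat_eq)
  have box: "\<bar>z k\<bar> \<le> int n" if "z \<in> Z" for z k
    using that cell_box[OF _ n(2)] unfolding Z_def by (auto simp: mem_cball)
  have Z: "finite Z"
    by (rule finite_subset[OF _ finite_cell_box[of "int n"]]) (use box in auto)
  define T where "T t = {x. cell m x \<in> Z \<and> mult t x \<noteq> 0}" for t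
  have TK: "T t \<subseteq> {x. x \<in> K \<and> mult t x \<noteq> 0}" for t
    unfolding T_def using near(1) by blast
  have "bounded K" by (simp add: K_def)
  then have T: "finite (T t)" for t
    by (rule finite_subset[OF TK finite_config_bounded])
  have cells: "(\<Sum>z\<in>Z. c z * real (config_count t {x. cell m x = z})) =
      (\<Sum>x\<in>T t. real (mult t x) * c (cell m x))" for c t
  proof -
    have "(\<Sum>x\<in>T t. real (mult t x) * c (cell m x)) =
        (\<Sum>z\<in>Z. \<Sum>x\<in>{x\<in>T t. cell m x = z}. real (mult t x) * c (cell m x))"
      by (rule sum.group[symmetric]) (auto simp: Z T, auto simp: T_def)
    also have "\<dots> = (\<Sum>z\<in>Z. c z * real (config_count t {x. cell m x = z}))"
    proof (rule sum.cong[OF refl])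
      fix z assume "z \<in> Z"
      then have "{x\<in>T t. cell m x = z} = {x. x \<in> {x. cell m x = z} \<and> mult t x \<noteq> 0}"
        by (auto simp: T_def)
      then show "(\<Sum>x\<in>{x\<in>T t. cell m x = z}. real (mult t x) * c (cell m x)) =
          c z * real (config_count t {x. cell m x = z})"
        by (simp add: config_count_def sum_distrib_left mult.commute)
    qed
    finally show ?thesis ..
  qed
  define L where "L t = (\<Sum>z\<in>Z. \<phi> (y z) * real (config_count t {x. cell m x = z}))" for t
  define N where "N t = (\<Sum>z\<in>Z. 1 * real (config_count t {x. cell m x = z}))" for t
  have approx: "\<bar>config_integral t \<phi> - L t\<bar> \<le> \<eta> * N t" for t
  proof -
    have "config_integral t \<phi> = (\<Sum>x\<in>T t. real (mult t x) * \<phi> x)"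
      unfolding config_integral_def
      by (rule sum.mono_neutral_left[OF T]) (auto simp: T_def Z_def r(2))
    then have "config_integral t \<phi> - L t =
        (\<Sum>x\<in>T t. real (mult t x) * (\<phi> x - \<phi> (y (cell m x))))"
      unfolding L_def cells by (simp add: sum_subtractf right_diff_distrib)
    also have "\<bar>\<dots>\<bar> \<le> (\<Sum>x\<in>T t. \<bar>real (mult t x) * (\<phi> x - \<phi> (y (cell m x)))\<bar>)"
      by (rule sum_abs)
    also have "\<dots> \<le> (\<Sum>x\<in>T t. real (mult t x) * \<eta>)"
      by (intro sum_mono) (auto simp: T_def abs_mult intro!: mult_left_mono near)
    also have "\<dots> = \<eta> * N t" unfolding N_def cells by (simp add: sum_distrib_left mult.commute)
    finally show ?thesis .
  qed
  have "N s \<le> M"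
  proof -
    have "N s = real (\<Sum>x\<in>T s. mult s x)" unfolding N_def cells by simp
    also have "\<dots> \<le> M"
      unfolding M_def config_count_def of_nat_le_iff
      by (rule sum_mono2[OF finite_config_bounded[OF \<open>bounded K\<close>] TK]) simp
    finally show ?thesis .
  qed
  then have small: "2 * (\<eta> * N s) < e"
  proof -
    have "\<eta> * N s \<le> \<eta> * M"
      by (rule mult_left_mono) (use \<open>N s \<le> M\<close> \<eta> in simp_all)
    moreover have "\<eta> * (2 * (M + 1)) = e"
    proof -
      have "2 * (M + 1) \<noteq> 0" using M by simp
      from nonzero_eq_divide_eq[OF this, of \<eta> e] \<eta>_def show ?thesis by blast
    qed
    then have "2 * (\<eta> * M) + 2 * \<eta> = e" by (simp only: algebra_simps)
    ultimately show ?thesis using \<eta> by linarith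
  qed
  have "config_integral t \<phi> \<in> U" if "cell_pattern n t = cell_pattern n s" for t
  proof -
    have "config_count t {x. cell m x = z} = config_count s {x. cell m x = z}" if "z \<in> Z" for z
      using fun_cong[OF \<open>cell_pattern n t = cell_pattern n s\<close>, of "(m, z)"] n(1) box[OF that]
      by (simp add: cell_pattern_def)
    then have "L t = L s" "N t = N s" unfolding L_def N_def by simp_all
    then have "\<bar>config_integral s \<phi> - config_integral t \<phi>\<bar> < e"
      using approx[of t] approx[of s] small by simp
    then show ?thesis using e(2) by (auto simp: dist_real_def)
  qed
  then show ?thesis by blast
qed

text \<open>Extends the previous lemma from the subbasic open sets to all open sets; finite intersections are where
the monotonicity of the tables in \<open>n\<close> enters. It says that the sets of configurations
with a given table form a countable network of the vague topology, and it takes the place of second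
countability below.\<close>

lemma open_config_cell_pattern:
  fixes U :: "'n::finite config set"
  assumes "open U" "s \<in> U"
  shows "\<exists>n. \<forall>t. cell_pattern n t = cell_pattern n s \<longrightarrow> t \<in> U"
proof -
  have "generate_topology {{s. config_integral s \<phi> \<in> U} | \<phi> U.
      continuous_on UNIV \<phi> \<and> compact (closure {x. \<phi> x \<noteq> 0}) \<and> open U} U"
    using assms(1) unfolding open_config_def .
  then show ?thesis using assms(2)
  proof induction
    case (Int A B)
    then obtain n n' where "\<forall>t. cell_pattern n t = cell_pattern n s \<longrightarrow> t \<in> A"
      "\<forall>t. cell_pattern n' t = cell_pattern n' s \<longrightarrow> t \<in> B" by blast
    then have "\<forall>t. cell_pattern (max n n') t = cell_pattern (max n n') s \<longrightarrow> t \<in> A \<inter> B"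
      using cell_pattern_mono[of n "max n n'"] cell_pattern_mono[of n' "max n n'"]
      by (metis IntI max.cobounded1 max.cobounded2)
    then show ?case by blast
  next
    case (UN \<K>)
    then obtain A where A: "A \<in> \<K>" "s \<in> A" by blast
    with UN.IH[OF A] show ?case by blast
  next
    case (Basis A)
    then obtain \<phi> V where "A = {s. config_integral s \<phi> \<in> V}" "continuous_on UNIV \<phi>"
      "compact (closure {x. \<phi> x \<noteq> 0})" "open V" by blast
    with cell_pattern_approximates[of \<phi> V s] Basis(2) show ?case by simp
  next
    case UNIV
    then show ?case by simp
  qed
qed

text \<open>The preimage of an open set is a countable union of sets described by finitely many counts.\<close>

lemma measurable_into_config:
  fixes f :: "'p \<Rightarrow> 'n::finite config"
  assumes f: "\<And>A. A \<in> sets borel \<Longrightarrow> bounded A \<Longrightarrow>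
    (\<lambda>p. config_sum (f p) (indicator A)) \<in> borel_measurable N"
  shows "f \<in> N \<rightarrow>\<^sub>M borel"
proof (rule borel_measurableI)
  fix U :: "'n config set" assume U: "open U"
  define I where "I n = {..n} \<times> {z :: 'n \<Rightarrow> int. \<forall>k. \<bar>z k\<bar> \<le> int n}" for n
  have I: "finite (I n)" for n unfolding I_def by (simp add: finite_cell_box)
  define G where "G n = {c \<in> (\<Pi>\<^sub>E i\<in>I n. UNIV). \<forall>t. cell_pattern n t = c \<longrightarrow> t \<in> U}" for n
  have "countable (\<Pi>\<^sub>E i\<in>I n. UNIV :: nat set)" for n by (intro countable_PiE I) auto
  then have G: "countable (G n)" for n
    unfolding G_def by (rule countable_subset[rotated]) auto
  have "{p \<in> space N. cell_pattern n (f p) = c} \<in> sets N" if "c \<in> G n" for n c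
  proof -
    have "{p \<in> space N. config_count (f p) {x. cell m x = z} = i} \<in> sets N" for m z i
    proof -
      have "(\<lambda>p. config_sum (f p) (indicator {x. cell m x = z})) -` {of_nat i} \<inter> space N \<in> sets N"
        by (intro measurable_sets[OF f] sets_cell bounded_cell) auto
      then show ?thesis
        by (rule back_subst[where P = "\<lambda>A. A \<in> sets N"])
           (auto simp: config_sum_indicator[OF bounded_cell])
    qed
    then have "{p \<in> space N. \<forall>i\<in>I n. config_count (f p) {x. cell (fst i) x = snd i} = c i} \<in> sets N"
      by (intro sets.sets_Collect_finite_All I) (auto simp: I_def)
    moreover have "cell_pattern n t = c \<longleftrightarrow> (\<forall>i\<in>I n. config_count t {x. cell (fst i) x = snd i} = c i)" for t
    proof -
      have ext: "cell_pattern n t \<in> extensional (I n)" "c \<in> extensional (I n)"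
        using that by (simp_all add: cell_pattern_def I_def G_def PiE_def)
      have "cell_pattern n t i = config_count t {x. cell (fst i) x = snd i}" if "i \<in> I n" for i
        using that unfolding cell_pattern_def I_def by (simp add: case_prod_beta)
      with extensionalityI[OF ext] show ?thesis by metis
    qed
    ultimately show ?thesis by simp
  qed
  then have "(\<Union>n. \<Union>c\<in>G n. {p \<in> space N. cell_pattern n (f p) = c}) \<in> sets N"
    by (intro sets.countable_UN'' sets.countable_UN' G) auto
  moreover have "f -` U \<inter> space N = (\<Union>n. \<Union>c\<in>G n. {p \<in> space N. cell_pattern n (f p) = c})"
  proof (intro equalityI subsetI)
    fix p assume p: "p \<in> f -` U \<inter> space N"
    then obtain n where "\<forall>t. cell_pattern n t = cell_pattern n (f p) \<longrightarrow> t \<in> U"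
      using open_config_cell_pattern[OF U, of "f p"] by auto
    then have "cell_pattern n (f p) \<in> G n"
      by (simp add: G_def I_def cell_pattern_def)
    then show "p \<in> (\<Union>n. \<Union>c\<in>G n. {p \<in> space N. cell_pattern n (f p) = c})" using p by blast
  qed (auto simp: G_def)
  ultimately show "f -` U \<inter> space N \<in> sets N" by simp
qed

section \<open>Measurable operations on configurations\<close>

lemma config_sum_shift: "config_sum (shift v s) f = config_sum s (\<lambda>y. f (y + v))"
proof -
  have "bij_betw (\<lambda>y. y + v) UNIV UNIV"
    by (intro bij_betwI[where g = "\<lambda>y. y - v"]) auto
  from nn_integral_bij_count_space[OF this, of "\<lambda>y. of_nat (mult (shift v s) y) * f y"]
  show ?thesis by (simp add: config_sum_def shift.rep_eq)
qed

text \<open>Measurability is with respect to any two measurable arguments, so it covers the product \<open>\<sigma>\<close>-algebra on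
pairs of a vector and a configuration.\<close>

lemma measurable_shift [measurable (raw)]:
  fixes \<xi> :: "'p \<Rightarrow> real ^ 'n::finite" and \<sigma> :: "'p \<Rightarrow> 'n config"
  assumes [measurable]: "\<xi> \<in> N \<rightarrow>\<^sub>M borel" "\<sigma> \<in> N \<rightarrow>\<^sub>M borel"
  shows "(\<lambda>p. shift (\<xi> p) (\<sigma> p)) \<in> N \<rightarrow>\<^sub>M borel"
proof (rule measurable_into_config)
  fix A :: "(real ^ 'n) set" assume [measurable]: "A \<in> sets borel"
  define E where "E = {q \<in> space (N \<Otimes>\<^sub>M borel). snd q + \<xi> (fst q) \<in> A}"
  have "E \<in> sets (N \<Otimes>\<^sub>M borel)" unfolding E_def by measurable
  from borel_measurable_config_sum_indicator[OF assms(2) this]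
  show "(\<lambda>p. config_sum (shift (\<xi> p) (\<sigma> p)) (indicator A)) \<in> borel_measurable N"
  proof (rule measurable_cong[THEN iffD1, rotated])
    fix p assume "p \<in> space N"
    then show "config_sum (\<sigma> p) (\<lambda>y. indicator E (p, y)) =
        config_sum (shift (\<xi> p) (\<sigma> p)) (indicator A)"
      unfolding config_sum_shift
      by (intro arg_cong[where f = "config_sum (\<sigma> p)"]) 
         (auto simp: E_def space_pair_measure indicator_def fun_eq_iff)
  qed
qed

lemma config_sum_singleton: "config_sum s (\<lambda>y. indicator {x} y * f y) = of_nat (mult s x) * f x"
proof -
  have "config_sum s (\<lambda>y. indicator {x} y * f y) =
      (\<integral>\<^sup>+y. (of_nat (mult s x) * f x) * indicator {x} y \<partial>count_space UNIV)"
    unfolding config_sum_def by (intro nn_integral_cong) (auto simp: indicator_def)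
  then show ?thesis by (simp add: nn_integral_cmult_indicator)
qed

text \<open>The multiplicity at a moving point is the sum over the configuration of the indicator of a graph.\<close>

lemma measurable_mult [measurable (raw)]:
  fixes \<xi> :: "'p \<Rightarrow> real ^ 'n::finite" and \<sigma> :: "'p \<Rightarrow> 'n config"
  assumes [measurable]: "\<xi> \<in> N \<rightarrow>\<^sub>M borel" "\<sigma> \<in> N \<rightarrow>\<^sub>M borel"
  shows "(\<lambda>p. mult (\<sigma> p) (\<xi> p)) \<in> N \<rightarrow>\<^sub>M count_space UNIV"
proof -
  define E where "E = {q \<in> space (N \<Otimes>\<^sub>M borel). snd q = \<xi> (fst q)}"
  have E: "E \<in> sets (N \<Otimes>\<^sub>M borel)" unfolding E_def by measurable
  have "config_sum (\<sigma> p) (\<lambda>y. indicator E (p, y)) = of_nat (mult (\<sigma> p) (\<xi> p))"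
    if "p \<in> space N" for p
  proof -
    have "(\<lambda>y. indicator E (p, y)) = (\<lambda>y. indicator {\<xi> p} y * (1 :: ennreal))"
      using that by (auto simp: E_def space_pair_measure indicator_def fun_eq_iff)
    then show ?thesis using config_sum_singleton[of "\<sigma> p" "\<xi> p" "\<lambda>_. 1"] by simp
  qed
  then have "(\<lambda>p. of_nat (mult (\<sigma> p) (\<xi> p)) :: ennreal) \<in> borel_measurable N"
    by (rule measurable_cong[THEN iffD1, OF _ borel_measurable_config_sum_indicator[OF assms(2) E]])
  then have "(\<lambda>p. of_nat (mult (\<sigma> p) (\<xi> p)) :: ennreal) -` {of_nat i} \<inter> space N \<in> sets N" for i
    by (rule measurable_sets) auto
  then have "(\<lambda>p. mult (\<sigma> p) (\<xi> p)) -` {i} \<inter> space N \<in> sets N" for i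
    by (simp add: vimage_def)
  then show ?thesis by (intro measurable_count_space_eq2_countable[THEN iffD2]) auto
qed

lemma config_sum_remove_point:
  assumes "mult s x \<noteq> 0" shows "config_sum s f = config_sum (remove_point x s) f + f x"
proof -
  have "of_nat (mult s y) * f y = of_nat (mult (remove_point x s) y) * f y + f x * indicator {x} y" for y
  proof (cases "y = x")
    case True
    have "mult s x = Suc (mult s x - 1)" using assms by simp
    then have "of_nat (mult s x) = (of_nat (mult s x - 1) + 1 :: ennreal)"
      by (metis of_nat_Suc add.commute)
    then show ?thesis using True by (simp add: remove_point.rep_eq distrib_right)
  qed (simp add: remove_point.rep_eq)
  then show ?thesis
    unfolding config_sum_def by (simp add: nn_integral_add nn_integral_cmult_indicator)
qed

lemma remove_point_absent: "mult s x = 0 \<Longrightarrow> remove_point x s = s"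
  by (simp add: mult_inject[symmetric] remove_point.rep_eq fun_eq_iff)

lemma measurable_remove_point [measurable (raw)]:
  fixes \<xi> :: "'p \<Rightarrow> real ^ 'n::finite" and \<sigma> :: "'p \<Rightarrow> 'n config"
  assumes [measurable]: "\<xi> \<in> N \<rightarrow>\<^sub>M borel" "\<sigma> \<in> N \<rightarrow>\<^sub>M borel"
  shows "(\<lambda>p. remove_point (\<xi> p) (\<sigma> p)) \<in> N \<rightarrow>\<^sub>M borel"
proof (rule measurable_into_config)
  fix A :: "(real ^ 'n) set" assume A [measurable]: "A \<in> sets borel" and b: "bounded A"
  have "(\<lambda>q. snd q) -` A \<inter> space (N \<Otimes>\<^sub>M borel) \<in> sets (N \<Otimes>\<^sub>M borel)" by measurable
  note m = borel_measurable_config_sum_indicator[OF assms(2) this]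
  have [measurable]: "(\<lambda>p. config_sum (\<sigma> p) (indicator A)) \<in> borel_measurable N"
    by (rule measurable_cong[THEN iffD1, OF _ m])
       (auto simp: space_pair_measure indicator_def intro!: arg_cong[where f = "config_sum _"])
  have "config_sum (remove_point (\<xi> p) (\<sigma> p)) (indicator A) =
      config_sum (\<sigma> p) (indicator A) - (if mult (\<sigma> p) (\<xi> p) = 0 then 0 else indicator A (\<xi> p))" for p
    by (auto simp: remove_point_absent config_sum_remove_point[of "\<sigma> p" "\<xi> p"] indicator_def)
  then show "(\<lambda>p. config_sum (remove_point (\<xi> p) (\<sigma> p)) (indicator A)) \<in> borel_measurable N"
    by simp
qed

lemma infinite_config_iff: "infinite_config s \<longleftrightarrow> config_sum s (\<lambda>_. 1) = \<top>"
proof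
  assume "infinite_config s"
  then have "(\<integral>\<^sup>+y. indicator {y. mult s y \<noteq> 0} y \<partial>count_space UNIV) = \<top>"
    by (simp add: infinite_config_def)
  moreover have "(\<integral>\<^sup>+y. indicator {y. mult s y \<noteq> 0} y \<partial>count_space UNIV) \<le> config_sum s (\<lambda>_. 1)"
    unfolding config_sum_def
    by (intro nn_integral_mono) (auto simp: indicator_def simp del: of_nat_1 simp: of_nat_le_iff[of 1, simplified] Suc_leI)
  ultimately show "config_sum s (\<lambda>_. 1) = \<top>" by (simp add: top_unique)
next
  assume *: "config_sum s (\<lambda>_. 1) = \<top>"
  show "infinite_config s"
  proof (rule ccontr)
    assume "\<not> infinite_config s"
    then have "bounded {y. mult s y \<noteq> 0}" by (simp add: infinite_config_def finite_imp_bounded)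
    moreover have "config_sum s (\<lambda>_. 1) = config_sum s (indicator {y. mult s y \<noteq> 0})"
      unfolding config_sum_def by (intro nn_integral_cong) (auto simp: indicator_def)
    ultimately show False using * by (simp add: config_sum_indicator)
  qed
qed

lemma sets_S_si [measurable]: "(S_si :: 'n::finite config set) \<in> sets borel"
proof -
  (* Configurations without multiple points are those over which the sum of the indicator of E vanishes. *)
  define E where "E = {q \<in> space (borel \<Otimes>\<^sub>M borel). 2 \<le> mult (fst q :: 'n config) (snd q)}"
  have "E \<in> sets (borel \<Otimes>\<^sub>M borel)" unfolding E_def by measurable
  from borel_measurable_config_sum_indicator[OF measurable_ident_sets[OF refl] this]
  have [measurable]: "(\<lambda>s. config_sum s (\<lambda>y. indicator E (s, y))) \<in> borel_measurable borel" by simp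
  have "space (borel \<Otimes>\<^sub>M borel) \<in> sets (borel \<Otimes>\<^sub>M borel :: ('n config \<times> (real ^ 'n)) measure)" by simp
  from borel_measurable_config_sum_indicator[OF measurable_ident_sets[OF refl] this]
  have [measurable]: "(\<lambda>s :: 'n config. config_sum s (\<lambda>y. 1)) \<in> borel_measurable borel"
    by (simp add: space_pair_measure)
  have "(\<forall>x. mult s x \<le> 1) \<longleftrightarrow> config_sum s (\<lambda>y. indicator E (s, y)) = 0" for s
  proof -
    have "config_sum s (\<lambda>y. indicator E (s, y)) = 0 \<longleftrightarrow>
        (\<forall>y. of_nat (mult s y) * (indicator E (s, y) :: ennreal) = 0)"
      unfolding config_sum_def by (simp add: nn_integral_0_iff_AE AE_count_space)
    also have "\<dots> \<longleftrightarrow> (\<forall>x. mult s x \<le> 1)"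
    proof -
      have "of_nat (mult s y) * (indicator E (s, y) :: ennreal) = 0 \<longleftrightarrow> mult s y \<le> 1" for y
        by (auto simp: E_def space_pair_measure indicator_def)
      then show ?thesis by simp
    qed
    finally show ?thesis ..
  qed
  then have eq: "S_si = {s \<in> space borel. config_sum s (\<lambda>y. indicator E (s, y)) = 0 \<and>
      config_sum s (\<lambda>_. 1) = \<top>}"
    by (simp add: S_si_def infinite_config_iff)
  show ?thesis unfolding eq by measurable
qed

section \<open>The reduced Campbell formula\<close>

lemma config_sum_ge: "of_nat (mult s x) * f x \<le> config_sum s f"
proof (cases "mult s x = 0")
  case False
  have "of_nat (mult s x) * f x = config_sum s (\<lambda>y. indicator {x} y * f y)"
    by (rule config_sum_singleton[symmetric])
  also have "\<dots> \<le> config_sum s f"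
    unfolding config_sum_def by (intro nn_integral_mono mult_left_mono) (auto simp: indicator_def)
  finally show ?thesis .
qed simp

text \<open>The definition of the reduced Palm measures gives this identity for rectangles. Both sides are measures in
\<open>E\<close>, finite because \<open>\<rho>1\<close> is integrable over \<open>A\<close>, so Dynkin's lemma applies. Additivity of the left-hand
side rests on the measurability of the sum over the points, which in turn uses that points can be
removed measurably.\<close>

lemma reduced_Campbell_formula:
  fixes \<mu> \<mu>\<^sub>0 :: "'n::finite config measure"
  assumes sets_\<mu>: "sets \<mu> = sets borel" and palm: "reduced_palm \<mu> \<rho>1 \<mu>\<^sub>0"
    and [measurable]: "\<rho>1 \<in> borel_measurable borel" "A \<in> sets borel"
    and fin: "(\<integral>\<^sup>+x. ennreal (\<rho>1 x) * indicator A x \<partial>lborel) < \<top>"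
    and E: "E \<in> sets (borel \<Otimes>\<^sub>M borel)"
  shows "(\<integral>\<^sup>+s. config_sum s (\<lambda>x. indicator A x * indicator E (x, remove_point x s)) \<partial>\<mu>) =
    (\<integral>\<^sup>+x. ennreal (\<rho>1 x) * indicator A x * (\<integral>\<^sup>+t. indicator E (x, shift x t) \<partial>\<mu>\<^sub>0) \<partial>lborel)"
    (is "?L E = ?R E")
proof -
  interpret \<mu>\<^sub>0: prob_space \<mu>\<^sub>0 using palm by (simp add: reduced_palm_def)
  have sets_\<mu>\<^sub>0: "sets \<mu>\<^sub>0 = sets borel" using palm by (simp add: reduced_palm_def)
  note [measurable_cong] = sets_\<mu> sets_\<mu>\<^sub>0
  have [measurable]: "UNIV \<in> sets (borel \<Otimes>\<^sub>M borel :: ((real ^ 'n) \<times> 'n config) measure)"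
    using sets.top[of "borel \<Otimes>\<^sub>M borel :: ((real ^ 'n) \<times> 'n config) measure"]
    by (simp add: space_pair_measure)
  have L_meas: "(\<lambda>s. config_sum s (\<lambda>x. indicator A x * indicator E (x, remove_point x s))) \<in> borel_measurable \<mu>"
    if [measurable]: "E \<in> sets (borel \<Otimes>\<^sub>M borel)" for E
  proof -
    define E' where "E' = {q \<in> space (\<mu> \<Otimes>\<^sub>M borel). snd q \<in> A \<and> (snd q, remove_point (snd q) (fst q)) \<in> E}"
    have E': "E' \<in> sets (\<mu> \<Otimes>\<^sub>M borel)" unfolding E'_def by measurable
    have id: "(\<lambda>s. s) \<in> \<mu> \<rightarrow>\<^sub>M borel" by measurable
    have "space \<mu> = UNIV" using sets_eq_imp_space_eq[OF sets_\<mu>] by simp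
    then have "config_sum s (\<lambda>x. indicator E' (s, x)) =
        config_sum s (\<lambda>x. indicator A x * indicator E (x, remove_point x s))" for s
      by (intro arg_cong[where f = "config_sum s"])
         (auto simp: E'_def space_pair_measure indicator_def fun_eq_iff)
    then show ?thesis using borel_measurable_config_sum_indicator[OF id E'] by simp
  qed
  have R_meas: "(\<lambda>x. \<integral>\<^sup>+t. indicator E (x, shift x t) \<partial>\<mu>\<^sub>0) \<in> borel_measurable lborel"
    if [measurable]: "E \<in> sets (borel \<Otimes>\<^sub>M borel)" for E
    by measurable
  have rectangle: "?L (B \<times> C) = ?R (B \<times> C)" if [measurable]: "B \<in> sets borel" "C \<in> sets borel" for B C
  proof -
    have "?L (B \<times> C) = (\<integral>\<^sup>+s. (\<integral>\<^sup>+x. of_nat (mult s x) * indicator (A \<inter> B) x * indicator C (remove_point x s)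
                  \<partial>count_space UNIV) \<partial>\<mu>)"
      unfolding config_sum_def by (intro nn_integral_cong) (auto simp: indicator_def)
    also have "\<dots> = (\<integral>\<^sup>+x. ennreal (\<rho>1 x) * emeasure (palm \<mu>\<^sub>0 x) C * indicator (A \<inter> B) x \<partial>lborel)"
      using palm unfolding reduced_palm_def by simp
    also have "\<dots> = ?R (B \<times> C)"
    proof (rule nn_integral_cong)
      fix x
      have "emeasure (palm \<mu>\<^sub>0 x) C = (\<integral>\<^sup>+t. indicator C t \<partial>palm \<mu>\<^sub>0 x)"
        by (simp add: palm_def)
      also have "\<dots> = (\<integral>\<^sup>+t. indicator C (shift x t) \<partial>\<mu>\<^sub>0)"
        unfolding palm_def by (rule nn_integral_distr) measurable
      finally have "emeasure (palm \<mu>\<^sub>0 x) C = (\<integral>\<^sup>+t. indicator C (shift x t) \<partial>\<mu>\<^sub>0)" .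
      then show "ennreal (\<rho>1 x) * emeasure (palm \<mu>\<^sub>0 x) C * indicator (A \<inter> B) x =
          ennreal (\<rho>1 x) * indicator A x * (\<integral>\<^sup>+t. indicator (B \<times> C) (x, shift x t) \<partial>\<mu>\<^sub>0)"
        by (auto simp: indicator_def)
    qed
    finally show ?thesis .
  qed
  have total: "?L UNIV < \<top>"
  proof -
    have "?L UNIV = ?R UNIV" using rectangle[of UNIV UNIV] by simp
    also have "\<dots> = (\<integral>\<^sup>+x. ennreal (\<rho>1 x) * indicator A x \<partial>lborel)"
      by (simp add: \<mu>\<^sub>0.emeasure_space_1)
    finally show ?thesis using fin by simp
  qed
  have rect: "{B \<times> C | B C. B \<in> sets borel \<and> C \<in> sets borel} \<subseteq> Pow (UNIV :: ((real ^ 'n) \<times> 'n config) set)"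
    by simp
  have "E \<in> sigma_sets UNIV {B \<times> C | B C. B \<in> sets borel \<and> C \<in> sets borel}"
    using E by (simp add: sets_pair_measure)
  from Int_stable_pair_measure_generator rect this show ?thesis
  proof (induction rule: sigma_sets_induct_disjoint)
    case (basic E)
    then show ?case using rectangle by blast
  next
    case empty
    then show ?case by (simp add: config_sum_def)
  next
    case (compl E)
    have [measurable]: "E \<in> sets (borel \<Otimes>\<^sub>M borel)"
      using compl(1) by (simp add: sets_pair_measure)
    have ind: "indicator E q + indicator (UNIV - E) q = (indicator UNIV q :: ennreal)" for q
      by (auto simp: indicator_def)
    have L_add: "?L E + ?L (UNIV - E) = ?L UNIV"
    proof -
      have eq: "config_sum s (\<lambda>x. indicator A x * indicator E (x, remove_point x s)) +
          config_sum s (\<lambda>x. indicator A x * indicator (UNIV - E) (x, remove_point x s)) =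
          config_sum s (\<lambda>x. indicator A x * indicator UNIV (x, remove_point x s))" for s
        unfolding config_sum_add[symmetric] distrib_left[symmetric] ind by (rule refl)
      have "UNIV - E \<in> sets (borel \<Otimes>\<^sub>M borel)" by measurable
      from nn_integral_add[OF L_meas[OF \<open>E \<in> sets (borel \<Otimes>\<^sub>M borel)\<close>] L_meas[OF this]]
      show ?thesis unfolding eq by (rule sym)
    qed
    have R_add: "?R E + ?R (UNIV - E) = ?R UNIV"
    proof -
      have "(\<integral>\<^sup>+t. indicator E (x, shift x t) \<partial>\<mu>\<^sub>0) + (\<integral>\<^sup>+t. indicator (UNIV - E) (x, shift x t) \<partial>\<mu>\<^sub>0) =
          (\<integral>\<^sup>+t. indicator UNIV (x, shift x t) \<partial>\<mu>\<^sub>0)" for x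
        by (subst nn_integral_add[symmetric], measurable) (simp only: ind)
      then have eq: "ennreal (\<rho>1 x) * indicator A x * (\<integral>\<^sup>+t. indicator E (x, shift x t) \<partial>\<mu>\<^sub>0) +
          ennreal (\<rho>1 x) * indicator A x * (\<integral>\<^sup>+t. indicator (UNIV - E) (x, shift x t) \<partial>\<mu>\<^sub>0) =
          ennreal (\<rho>1 x) * indicator A x * (\<integral>\<^sup>+t. indicator UNIV (x, shift x t) \<partial>\<mu>\<^sub>0)" for x
        by (simp only: distrib_left[symmetric])
      show ?thesis by (subst nn_integral_add[symmetric], measurable) (simp only: eq)
    qed
    have "?L E \<le> ?L UNIV" unfolding L_add[symmetric] by (rule add_increasing2[OF zero_le order_refl])
    from le_less_trans[OF this total] have "?L E \<noteq> \<infinity>"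
      unfolding infinity_ennreal_def by (rule less_top[THEN iffD2])
    moreover have "?L UNIV = ?R UNIV" using rectangle[of UNIV UNIV] by simp
    ultimately have "?L E + ?L (UNIV - E) = ?L E + ?R (UNIV - E)"
      using L_add R_add compl(2) by (simp only:)
    then have "?L E = \<infinity> \<or> ?L (UNIV - E) = ?R (UNIV - E)"
      by (rule ennreal_add_left_cancel[THEN iffD1])
    with \<open>?L E \<noteq> \<infinity>\<close> show ?case by blast
  next
    case (union F)
    have [measurable]: "F i \<in> sets (borel \<Otimes>\<^sub>M borel)" for i
      using union(2) by (auto simp: sets_pair_measure)
    have ind: "(indicator (\<Union>i. F i) q :: ennreal) = (\<Sum>i. indicator (F i) q)" for q
      by (rule suminf_indicator[symmetric, OF union(1)])
    have "?L (\<Union>i. F i) = (\<Sum>i. ?L (F i))"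
      unfolding ind ennreal_suminf_cmult[symmetric] config_sum_suminf
      by (rule nn_integral_suminf[OF L_meas]) measurable
    also have "\<dots> = (\<Sum>i. ?R (F i))" using union by simp
    also have "\<dots> = (\<integral>\<^sup>+x. (\<Sum>i. ennreal (\<rho>1 x) * indicator A x * (\<integral>\<^sup>+t. indicator (F i) (x, shift x t) \<partial>\<mu>\<^sub>0)) \<partial>lborel)"
      by (rule nn_integral_suminf[symmetric]) (auto intro!: borel_measurable_times_ennreal R_meas)
    also have "\<dots> = ?R (\<Union>i. F i)"
    proof (rule nn_integral_cong)
      fix x
      have "(\<integral>\<^sup>+t. (\<Sum>i. indicator (F i) (x, shift x t)) \<partial>\<mu>\<^sub>0) =
          (\<Sum>i. \<integral>\<^sup>+t. indicator (F i) (x, shift x t) \<partial>\<mu>\<^sub>0)"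
        by (rule nn_integral_suminf) measurable
      then show "(\<Sum>i. ennreal (\<rho>1 x) * indicator A x * (\<integral>\<^sup>+t. indicator (F i) (x, shift x t) \<partial>\<mu>\<^sub>0)) =
          ennreal (\<rho>1 x) * indicator A x * (\<integral>\<^sup>+t. indicator (\<Union>i. F i) (x, shift x t) \<partial>\<mu>\<^sub>0)"
        unfolding ind by (simp only: ennreal_suminf_cmult)
    qed
    finally show ?case .
  qed
qed

lemma shift_shift_inverse [simp]: "shift (- x) (shift x s) = s"
  by (simp add: mult_inject[symmetric] shift.rep_eq)

text \<open>Applying the reduced Campbell formula to the set of \<open>(x, t)\<close> with \<open>\<theta>\<^bsub>-x\<^esub> t \<in> C\<close> cancels the shift
in \<open>\<mu>\<^sub>x = \<mu>\<^sub>0 \<circ> \<theta>\<^sub>x\<^sup>-\<^sup>1\<close>.\<close>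

lemma Campbell_environment:
  fixes \<mu> \<mu>\<^sub>0 :: "'n::finite config measure"
  assumes "sets \<mu> = sets borel" "reduced_palm \<mu> \<rho>1 \<mu>\<^sub>0"
    and "\<rho>1 \<in> borel_measurable borel" "A \<in> sets borel"
    and "(\<integral>\<^sup>+x. ennreal (\<rho>1 x) * indicator A x \<partial>lborel) < \<top>"
    and C [measurable]: "C \<in> sets borel"
  shows "(\<integral>\<^sup>+s. config_sum s (\<lambda>x. indicator A x * indicator C (environment s x)) \<partial>\<mu>) =
    (\<integral>\<^sup>+x. ennreal (\<rho>1 x) * indicator A x \<partial>lborel) * emeasure \<mu>\<^sub>0 C"
proof -
  define E where "E = {q \<in> space (borel \<Otimes>\<^sub>M borel). shift (- fst q) (snd q :: 'n config) \<in> C}"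
  have "E \<in> sets (borel \<Otimes>\<^sub>M borel)" unfolding E_def by measurable
  from reduced_Campbell_formula[OF assms(1-5) this]
  have "(\<integral>\<^sup>+s. config_sum s (\<lambda>x. indicator A x * indicator C (environment s x)) \<partial>\<mu>) =
      (\<integral>\<^sup>+x. ennreal (\<rho>1 x) * indicator A x * (\<integral>\<^sup>+t. indicator C t \<partial>\<mu>\<^sub>0) \<partial>lborel)"
    by (simp add: E_def environment_def space_pair_measure indicator_def)
  also have "(\<integral>\<^sup>+t. indicator C t \<partial>\<mu>\<^sub>0) = emeasure \<mu>\<^sub>0 C"
    using assms(2) by (simp add: reduced_palm_def)
  finally show ?thesis using assms(3,4) by (simp add: nn_integral_multc)
qed

text \<open>On \<open>D\<close> the sum in the Campbell formula has a term that is at least \<open>1\<close>. This is how smallness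
under \<open>\<mu>\<^sub>0\<close> is turned into smallness under \<open>\<mu>\<close>.\<close>

lemma measure_labelled_environment_le:
  fixes \<mu> \<mu>\<^sub>0 :: "'n::finite config measure"
  assumes "sets \<mu> = sets borel" and palm: "reduced_palm \<mu> \<rho>1 \<mu>\<^sub>0"
    and "\<rho>1 \<in> borel_measurable borel" "A \<in> sets borel"
    and fin: "(\<integral>\<^sup>+x. ennreal (\<rho>1 x) * indicator A x \<partial>lborel) < \<top>"
    and C: "C \<in> sets borel"
    and D: "D \<in> sets \<mu>" "\<And>s. s \<in> D \<Longrightarrow> \<exists>x\<in>A. mult s x \<noteq> 0 \<and> environment s x \<in> C"
  shows "measure \<mu> D \<le> enn2real (\<integral>\<^sup>+x. ennreal (\<rho>1 x) * indicator A x \<partial>lborel) * measure \<mu>\<^sub>0 C"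
proof -
  interpret \<mu>\<^sub>0: prob_space \<mu>\<^sub>0 using palm by (simp add: reduced_palm_def)
  let ?I = "\<integral>\<^sup>+x. ennreal (\<rho>1 x) * indicator A x \<partial>lborel"
  have "emeasure \<mu> D = (\<integral>\<^sup>+s. indicator D s \<partial>\<mu>)" using D(1) by simp
  also have "\<dots> \<le> (\<integral>\<^sup>+s. config_sum s (\<lambda>x. indicator A x * indicator C (environment s x)) \<partial>\<mu>)"
  proof (rule nn_integral_mono)
    fix s
    show "indicator D s \<le> config_sum s (\<lambda>x. indicator A x * indicator C (environment s x))"
    proof (cases "s \<in> D")
      case True
      then obtain x where x: "x \<in> A" "mult s x \<noteq> 0" "environment s x \<in> C" using D(2) by blast
      have "(1 :: ennreal) \<le> of_nat (mult s x)" using x(2) by (metis Suc_leI of_nat_1 of_nat_mono neq0_conv One_nat_def)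
      also have "\<dots> = of_nat (mult s x) * (indicator A x * indicator C (environment s x))"
        using x by simp
      also have "\<dots> \<le> config_sum s (\<lambda>x. indicator A x * indicator C (environment s x))"
        by (rule config_sum_ge)
      finally show ?thesis using True by simp
    qed simp
  qed
  also have "\<dots> = ?I * emeasure \<mu>\<^sub>0 C"
    by (rule Campbell_environment[OF assms(1-6)])
  finally have "emeasure \<mu> D \<le> ?I * emeasure \<mu>\<^sub>0 C" .
  moreover have "emeasure \<mu>\<^sub>0 C < \<top>"
    by (rule less_top[THEN iffD1, OF \<mu>\<^sub>0.emeasure_finite[unfolded infinity_ennreal_def]])
  then have "?I * emeasure \<mu>\<^sub>0 C < \<top>"
    using fin by (simp add: ennreal_mult_less_top)
  ultimately have "enn2real (emeasure \<mu> D) \<le> enn2real (?I * emeasure \<mu>\<^sub>0 C)"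
    by (rule enn2real_mono)
  then show ?thesis by (simp add: measure_def enn2real_mult)
qed

section \<open>Displacement of the tagged particle\<close>

definition tagged_displacement ::
    "real \<Rightarrow> ('a::real_normed_vector \<times> 'b::topological_space) cpath \<Rightarrow> 'a cpath" where
  "tagged_displacement \<epsilon> w = rescale \<epsilon> (map_path fst (centered_path w))"

lemma path_at_map_path_fst [simp]:
  fixes w :: "('a::topological_space \<times> 'b::topological_space) cpath"
  shows "path_at (map_path fst w) t = fst (path_at w t)"
  by (rule path_at_map_path) (intro continuous_intros)

lemma centered_rescale_eq:
  fixes w :: "('a::real_normed_vector \<times> 'b::topological_space) cpath"
  shows "map_path (\<lambda>y. y - \<epsilon> *\<^sub>R fst (path_at w 0)) (rescale \<epsilon> (map_path fst w)) = tagged_displacement \<epsilon> w"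
proof -
  have "continuous_on UNIV (\<lambda>y :: 'a. y - \<epsilon> *\<^sub>R fst (path_at w 0))" by (intro continuous_intros)
  then show ?thesis
    by (simp add: path_at_inject[symmetric] fun_eq_iff path_at_map_path tagged_displacement_def
        rescale.rep_eq path_at_centered_path scaleR_diff_right)
qed

lemma rescale_tagged_path:
  fixes w :: "('a::real_normed_vector \<times> 'b::topological_space) cpath"
  assumes "fst (path_at w 0) = x"
  shows "rescale \<epsilon> (map_path fst w) = translate_path (\<epsilon> *\<^sub>R x) (tagged_displacement \<epsilon> w)"
  using assms
  by (simp add: path_at_inject[symmetric] fun_eq_iff tagged_displacement_def
      rescale.rep_eq path_at_centered_path scaleR_diff_right)

lemma continuous_on_rescale_fst:
  "continuous_on UNIV (\<lambda>w. rescale \<epsilon> (map_path fst w) :: 'a::real_normed_vector cpath)"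
  for \<epsilon> :: real
  by (rule continuous_on_compose2[OF continuous_on_rescale continuous_on_map_path])
     (auto intro!: continuous_intros)

lemma continuous_on_tagged_displacement: "continuous_on UNIV (tagged_displacement \<epsilon>)"
  unfolding tagged_displacement_def[abs_def]
  by (rule continuous_on_compose2[OF continuous_on_rescale_fst continuous_on_centered_path]) auto

lemma distr_eq_integral_eq:
  fixes g :: "'c \<Rightarrow> real"
  assumes "distr M N f = distr M' N f'" "f \<in> M \<rightarrow>\<^sub>M N" "f' \<in> M' \<rightarrow>\<^sub>M N" "g \<in> borel_measurable N"
  shows "(\<integral>w. g (f w) \<partial>M) = (\<integral>w. g (f' w) \<partial>M')"
  using integral_distr[OF assms(2,4)] integral_distr[OF assms(3,4)] assms(1) by simp

text \<open>The rescaled path of the tagged particle is a translate of a functional of the centred path, and the law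
of the centred path is the same for all initial positions.\<close>

lemma integral_tagged_path:
  fixes PXY :: "(real ^ 'n::finite) \<times> 'n config \<Rightarrow> ((real ^ 'n) \<times> 'n config) cpath measure"
    and F :: "(real ^ 'n) cpath \<Rightarrow> real"
  assumes sets_PXY: "\<And>q. sets (PXY q) = sets borel"
    and start: "\<And>q. AE w in PXY q. path_at w 0 = q"
    and centered: "\<And>x x' s. distr (PXY (x, s)) borel centered_path = distr (PXY (x', s)) borel centered_path"
    and F: "continuous_on UNIV F"
  shows "(\<integral>w. F (rescale \<epsilon> (map_path fst w)) \<partial>PXY (x, e)) =
    (\<integral>w. F (translate_path (\<epsilon> *\<^sub>R x) (tagged_displacement \<epsilon> w)) \<partial>PXY (0, e))"
proof -
  have mF [measurable]: "F \<in> borel_measurable borel"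
    by (rule borel_measurable_continuous_onI[OF F])
  have [measurable]: "(\<lambda>w :: ((real ^ 'n) \<times> 'n config) cpath. rescale \<epsilon> (map_path fst w)) \<in> borel \<rightarrow>\<^sub>M borel"
    by (rule borel_measurable_continuous_onI[OF continuous_on_rescale_fst])
  have [measurable]: "(tagged_displacement \<epsilon> :: ((real ^ 'n) \<times> 'n config) cpath \<Rightarrow> _) \<in> borel \<rightarrow>\<^sub>M borel"
    by (rule borel_measurable_continuous_onI[OF continuous_on_tagged_displacement])
  have [measurable]: "translate_path y \<in> (borel :: (real ^ 'n) cpath measure) \<rightarrow>\<^sub>M borel" for y
    unfolding translate_path_def
    by (intro borel_measurable_continuous_onI continuous_on_map_path continuous_intros)
  note [measurable_cong] = sets_PXY
  have c [measurable]: "(centered_path :: ((real ^ 'n) \<times> 'n config) cpath \<Rightarrow> _) \<in> borel \<rightarrow>\<^sub>M borel"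
    by (rule borel_measurable_continuous_onI[OF continuous_on_centered_path])
  have "(\<integral>w. F (rescale \<epsilon> (map_path fst w)) \<partial>PXY (x, e)) =
      (\<integral>w. F (translate_path (\<epsilon> *\<^sub>R x) (tagged_displacement \<epsilon> w)) \<partial>PXY (x, e))"
  proof (rule integral_cong_AE)
    show "AE w in PXY (x, e). F (rescale \<epsilon> (map_path fst w)) =
        F (translate_path (\<epsilon> *\<^sub>R x) (tagged_displacement \<epsilon> w))"
      using start[of "(x, e)"] by eventually_elim (simp add: rescale_tagged_path)
  qed measurable
  also have "\<dots> = (\<integral>w. F (translate_path (\<epsilon> *\<^sub>R x) (tagged_displacement \<epsilon> w)) \<partial>PXY (0, e))"
    unfolding tagged_displacement_def
    by (rule distr_eq_integral_eq[OF centered[of x e 0],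
          where g = "\<lambda>v. F (translate_path (\<epsilon> *\<^sub>R x) (rescale \<epsilon> (map_path fst v)))"]) measurable
  finally show ?thesis .
qed

section \<open>Functionals of the limiting Brownian motion\<close>

definition Brownian_mean ::
    "'w measure \<Rightarrow> ('w \<Rightarrow> (real ^ 'n::finite) cpath) \<Rightarrow> ((real ^ 'n) cpath \<Rightarrow> real) \<Rightarrow> real ^ 'n ^ 'n \<Rightarrow> real" where
  "Brownian_mean W B F A = (\<integral>\<omega>. F (map_path (\<lambda>y. A *v y) (B \<omega>)) \<partial>W)"

context
  fixes W :: "'w measure" and B :: "'w \<Rightarrow> (real ^ 'n::finite) cpath"
  assumes W: "prob_space W" and B [measurable]: "B \<in> W \<rightarrow>\<^sub>M borel"
begin

interpretation prob_space W by (rule W)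

lemma measurable_matrix_path:
  fixes F :: "(real ^ 'n::finite) cpath \<Rightarrow> real"
  assumes "continuous_on UNIV F"
  shows "(\<lambda>\<omega>. F (map_path (\<lambda>y. (A :: real ^ 'n ^ 'n) *v y) (B \<omega>))) \<in> borel_measurable W"
proof -
  have "continuous_on UNIV (\<lambda>w. F (map_path (\<lambda>y. A *v y) w))"
    by (rule continuous_on_compose2[OF assms continuous_on_map_path])
       (auto intro!: matrix_vector_mult_linear_continuous_on)
  then show ?thesis using B by (intro measurable_compose[OF B] borel_measurable_continuous_onI)
qed

text \<open>Measurability in the environment is obtained from continuity in the matrix, which follows by dominated
convergence. Joint measurability in the matrix and the path would be less direct: the Borel
\<open>\<sigma>\<close>-algebra of the product with the path space need not be the product \<open>\<sigma>\<close>-algebra a priori.\<close>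

lemma continuous_on_Brownian_mean:
  assumes F: "continuous_on UNIV F" and C: "\<And>w. \<bar>F w\<bar> \<le> C"
  shows "continuous_on UNIV (Brownian_mean W B F)"
proof (unfold continuous_on_sequentially o_def, intro ballI allI impI)
  fix A :: "real ^ 'n ^ 'n" and u
  assume "(\<forall>n. u n \<in> UNIV) \<and> u \<longlonglongrightarrow> A"
  then have u: "u \<longlonglongrightarrow> A" by simp
  have "continuous_on UNIV (\<lambda>(w, A) . map_path (\<lambda>y. (A :: real ^ 'n ^ 'n) *v y) w)"
    by (rule continuous_on_map_path_parameter) (rule continuous_on_matrix_vector_mult)
  from continuous_on_compose2[OF F this]
  have joint: "continuous_on UNIV (\<lambda>p. F (case p of (w, A) \<Rightarrow> map_path (\<lambda>y. (A :: real ^ 'n ^ 'n) *v y) w))"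
    by simp
  have "continuous_on UNIV (\<lambda>A. F (map_path (\<lambda>y. (A :: real ^ 'n ^ 'n) *v y) w))" for w
    using continuous_on_compose2[OF joint, of UNIV "\<lambda>A. (w, A)"]
    by (simp add: continuous_on_Pair continuous_on_const continuous_on_id)
  then have "(\<lambda>n. F (map_path (\<lambda>y. u n *v y) w)) \<longlonglongrightarrow> F (map_path (\<lambda>y. A *v y) w)" for w
    using u unfolding continuous_on_sequentially o_def by blast
  then show "(\<lambda>n. Brownian_mean W B F (u n)) \<longlonglongrightarrow> Brownian_mean W B F A"
    unfolding Brownian_mean_def
    by (intro integral_dominated_convergence[where w = "\<lambda>_. C"] measurable_matrix_path F)
       (auto simp: C)
qed

lemma Brownian_mean_modulus_tendsto_0:
  assumes F: "continuous_on UNIV F" and C: "\<And>w. \<bar>F w\<bar> \<le> C"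
  shows "(\<lambda>n. Brownian_mean W B (translation_modulus F (1 / real (Suc n))) A) \<longlonglongrightarrow> 0"
proof -
  have "(\<lambda>n. Brownian_mean W B (translation_modulus F (1 / real (Suc n))) A) \<longlonglongrightarrow> (\<integral>\<omega>. 0 \<partial>W)"
    unfolding Brownian_mean_def
  proof (rule integral_dominated_convergence[where w = "\<lambda>_. 2 * C"])
    fix n
    show "AE \<omega> in W. norm (translation_modulus F (1 / real (Suc n)) (map_path ((*v) A) (B \<omega>))) \<le> 2 * C"
      using translation_modulus_nonneg[OF F C, of "1 / real (Suc n)"]
        translation_modulus_le[OF F C, of "1 / real (Suc n)"] by simp
    show "(\<lambda>\<omega>. translation_modulus F (1 / real (Suc n)) (map_path ((*v) A) (B \<omega>))) \<in> borel_measurable W"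
      by (intro measurable_matrix_path continuous_on_translation_modulus[OF F C]) simp
  qed (use translation_modulus_tendsto_0[OF F C] in auto)
  then show ?thesis by simp
qed

end

lemma borel_measurable_kernel_integral:
  fixes G :: "'c::topological_space cpath \<Rightarrow> real"
  assumes K: "K \<in> borel \<rightarrow>\<^sub>M prob_algebra borel" and G: "G \<in> borel_measurable borel"
  shows "(\<lambda>e :: 'b::topological_space. \<integral>w. G w \<partial>K (x :: 'a::topological_space, e)) \<in> borel_measurable borel"
proof -
  have "(\<lambda>e :: 'b. (x, e)) \<in> borel \<rightarrow>\<^sub>M borel"
    by (intro borel_measurable_continuous_onI continuous_intros)
  from measurable_compose[OF measurable_compose[OF this measurable_prob_algebraD[OF K]]
      integral_measurable_subprob_algebra[OF G]]
  show ?thesis .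
qed

section \<open>Localisation by the label and the invariance principle\<close>

text \<open>A label lists each point as often as its multiplicity, which is at most \<open>1\<close> here.\<close>

lemma label_point:
  assumes l: "is_label l" and s: "s \<in> S_si" shows "mult s (l s i) = 1"
proof -
  have fin: "finite {j. l s j = l s i}" "card {j. l s j = l s i} = mult s (l s i)"
    using l s unfolding is_label_def by blast+
  have "card {j. l s j = l s i} \<noteq> 0" using fin(1) by auto
  moreover have "mult s (l s i) \<le> 1" using s by (simp add: S_si_def)
  ultimately show ?thesis using fin(2) by linarith
qed

lemma sets_label_norm:
  fixes l :: "'n::finite config \<Rightarrow> int \<Rightarrow> real ^ 'n"
  assumes l: "is_label l" shows "{s \<in> S_si. r < norm (l s i)} \<in> sets borel"
proof -
  have l' [measurable]: "l \<in> restrict_space borel S_si \<rightarrow>\<^sub>M (\<Pi>\<^sub>M i\<in>UNIV. borel)"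
    using l by (simp add: is_label_def)
  have "(\<lambda>s. l s i) \<in> restrict_space borel S_si \<rightarrow>\<^sub>M borel"
    by (rule measurable_compose[OF l' measurable_component_singleton]) simp
  then have "{s \<in> space (restrict_space borel S_si). r < norm (l s i)} \<in> sets (restrict_space borel S_si)"
    by measurable
  then show ?thesis
    by (simp add: space_restrict_space sets_restrict_space_iff)
qed

lemma label_tight:
  fixes \<mu> :: "'n::finite config measure"
  assumes "prob_space \<mu>" "sets \<mu> = sets borel" "is_label l" "\<eta> > 0"
  shows "\<exists>R::nat. measure \<mu> {s \<in> S_si. real R < norm (l s i)} < \<eta>"
proof -
  interpret prob_space \<mu> by fact
  have "(\<lambda>R::nat. measure \<mu> {s \<in> S_si. real R < norm (l s i)}) \<longlonglongrightarrow>
      measure \<mu> (\<Inter>R::nat. {s \<in> S_si. real R < norm (l s i)})"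
  proof (rule finite_Lim_measure_decseq)
    show "range (\<lambda>R::nat. {s \<in> S_si. real R < norm (l s i)}) \<subseteq> sets \<mu>"
      unfolding assms(2) using sets_label_norm[OF assms(3)] by blast
    show "decseq (\<lambda>R::nat. {s \<in> S_si. real R < norm (l s i)})"
      unfolding decseq_def by (force intro: le_less_trans)
  qed
  moreover have "(\<Inter>R::nat. {s \<in> S_si. real R < norm (l s i)}) = {}"
  proof -
    have "\<exists>R::nat. \<not> real R < norm (l s i)" for s
      using real_arch_simple[of "norm (l s i)"] by (auto simp: not_less)
    then show ?thesis by blast
  qed
  ultimately have "(\<lambda>R::nat. measure \<mu> {s \<in> S_si. real R < norm (l s i)}) \<longlonglongrightarrow> 0" by simp
  then have "eventually (\<lambda>R::nat. measure \<mu> {s \<in> S_si. real R < norm (l s i)} < \<eta>) sequentially"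
    using assms(4) by (rule order_tendstoD)
  then show ?thesis by (auto simp: eventually_sequentially)
qed

lemma measure_upper_level_tendsto_0:
  fixes J :: "nat \<Rightarrow> 'x \<Rightarrow> real"
  assumes M: "finite_measure M" and J: "\<And>n. J n \<in> borel_measurable M"
    and lim: "\<And>x. (\<lambda>n. J n x) \<longlonglongrightarrow> 0" and \<kappa>: "\<kappa> > 0"
  shows "(\<lambda>n. measure M {x \<in> space M. \<kappa> \<le> J n x}) \<longlonglongrightarrow> 0"
proof -
  interpret finite_measure M by fact
  note [measurable] = J
  have "(\<lambda>n. \<integral>x. indicator {x \<in> space M. \<kappa> \<le> J n x} x \<partial>M) \<longlonglongrightarrow> (\<integral>x. (0 :: real) \<partial>M)"
  proof (intro integral_dominated_convergence[where w = "\<lambda>_. 1 :: real"])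
    show "AE x in M. (\<lambda>n. indicator {x \<in> space M. \<kappa> \<le> J n x} x :: real) \<longlonglongrightarrow> 0"
    proof (rule AE_I2)
      fix x
      have "eventually (\<lambda>n. J n x < \<kappa>) sequentially" by (rule order_tendstoD(2)[OF lim \<kappa>])
      then have "eventually (\<lambda>n. indicator {x \<in> space M. \<kappa> \<le> J n x} x = (0 :: real)) sequentially"
        by eventually_elim simp
      then show "(\<lambda>n. indicator {x \<in> space M. \<kappa> \<le> J n x} x :: real) \<longlonglongrightarrow> 0"
        by (rule tendsto_eventually)
    qed
    show "(\<lambda>x. indicator {x \<in> space M. \<kappa> \<le> J n x} x :: real) \<in> borel_measurable M" for n
      by measurable
    show "AE x in M. norm (indicator {x \<in> space M. \<kappa> \<le> J n x} x :: real) \<le> 1" for n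
      by (simp add: indicator_def)
  qed simp_all
  then show ?thesis by simp
qed

lemma intensity_finite:
  fixes \<rho> :: "nat \<Rightarrow> (nat \<Rightarrow> real ^ 'n::finite) \<Rightarrow> real"
  assumes \<rho>: "correlation_function \<mu> 1 (\<rho> 1)" "locally_bounded 1 (\<rho> 1)"
  shows "one_point \<rho> \<in> borel_measurable borel"
    and "(\<integral>\<^sup>+x. ennreal (one_point \<rho> x) * indicator (cball 0 R) x \<partial>lborel) < \<top>"
proof -
  have m: "\<rho> 1 \<in> borel_measurable (\<Pi>\<^sub>M i\<in>{..<1}. lborel)"
    using \<rho>(1) unfolding correlation_function_def by (rule conjunct1)
  show "one_point \<rho> \<in> borel_measurable borel"
    unfolding one_point_def[abs_def]
    by (rule measurable_compose[OF measurable_restrict m]) simp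
  obtain C where C: "\<forall>x\<in>extensional {..<1}. (\<forall>i<1. norm (x i) \<le> R) \<longrightarrow> \<bar>\<rho> 1 x\<bar> \<le> C"
    using spec[OF \<rho>(2)[unfolded locally_bounded_def], of R] by (elim exE)
  have le: "one_point \<rho> x \<le> C" if "norm x \<le> R" for x
  proof -
    have "\<bar>\<rho> 1 (\<lambda>i\<in>{..<1}. x)\<bar> \<le> C"
    proof (rule C[rule_format])
      show "(\<lambda>i\<in>{..<1}. x) \<in> extensional {..<1 :: nat}" by (rule restrict_extensional)
      show "norm ((\<lambda>i\<in>{..<1 :: nat}. x) i) \<le> R" if "i < 1" for i
        using that \<open>norm x \<le> R\<close> by simp
    qed
    then show ?thesis unfolding one_point_def by linarith
  qed
  have "(\<integral>\<^sup>+x. ennreal (one_point \<rho> x) * indicator (cball 0 R) x \<partial>lborel) \<le>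
      (\<integral>\<^sup>+x. ennreal C * indicator (cball (0 :: real ^ 'n) R) x \<partial>lborel)"
  proof (rule nn_integral_mono)
    fix x :: "real ^ 'n"
    show "ennreal (one_point \<rho> x) * indicator (cball 0 R) x \<le> ennreal C * indicator (cball 0 R) x"
      using ennreal_leI[OF le, of x] by (cases "x \<in> cball 0 R") simp_all
  qed
  also have "\<dots> = ennreal C * emeasure lborel (cball (0 :: real ^ 'n) R)"
    by (rule nn_integral_cmult_indicator) simp
  also have "\<dots> < \<top>"
    using emeasure_lborel_cball_finite[of "0 :: real ^ 'n" R]
    unfolding ennreal_mult_less_top infinity_ennreal_def
    using ennreal_less_top by blast
  finally show "(\<integral>\<^sup>+x. ennreal (one_point \<rho> x) * indicator (cball 0 R) x \<partial>lborel) < \<top>" .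
qed

text \<open>The estimate is uniform in the translation \<open>y\<close>, which depends on the starting position of the particle,
and its right-hand side is independent of that position.\<close>

lemma translated_mean_le:
  fixes K :: "((real ^ 'n::finite) \<times> 'n config) cpath measure" and F :: "(real ^ 'n) cpath \<Rightarrow> real"
  assumes K: "prob_space K" "sets K = sets borel"
    and F: "continuous_on UNIV F" and C: "\<And>w. \<bar>F w\<bar> \<le> C" and y: "norm y \<le> \<delta>"
  shows "\<bar>(\<integral>w. F (translate_path y (tagged_displacement \<epsilon> w)) \<partial>K) - (\<integral>w. F (tagged_displacement \<epsilon> w) \<partial>K)\<bar>
    \<le> (\<integral>w. translation_modulus F \<delta> (tagged_displacement \<epsilon> w) \<partial>K)"
proof -
  interpret prob_space K by fact
  note [measurable_cong] = K(2)
  have \<delta>: "0 \<le> \<delta>" using y norm_ge_zero order_trans by blast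
  have [measurable]: "F \<in> borel_measurable borel" "translation_modulus F \<delta> \<in> borel_measurable borel"
    by (auto intro!: borel_measurable_continuous_onI F continuous_on_translation_modulus[OF F C \<delta>])
  have [measurable]: "(tagged_displacement \<epsilon> :: ((real ^ 'n) \<times> 'n config) cpath \<Rightarrow> _) \<in> borel \<rightarrow>\<^sub>M borel"
    by (rule borel_measurable_continuous_onI[OF continuous_on_tagged_displacement])
  have [measurable]: "translate_path y \<in> (borel :: (real ^ 'n) cpath measure) \<rightarrow>\<^sub>M borel"
    unfolding translate_path_def
    by (intro borel_measurable_continuous_onI continuous_on_map_path continuous_intros)
  have int: "integrable K (\<lambda>w. F (translate_path y (tagged_displacement \<epsilon> w)))"
      "integrable K (\<lambda>w. F (tagged_displacement \<epsilon> w))"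
    by (rule integrable_const_bound[of _ C], use C in simp, measurable)+
  have int_mod: "integrable K (\<lambda>w. translation_modulus F \<delta> (tagged_displacement \<epsilon> w))"
    using translation_modulus_nonneg[OF F C \<delta>] translation_modulus_le[OF F C \<delta>]
    by (intro integrable_const_bound[of _ "2 * C"]) auto
  have "\<bar>\<integral>w. F (translate_path y (tagged_displacement \<epsilon> w)) - F (tagged_displacement \<epsilon> w) \<partial>K\<bar>
      \<le> (\<integral>w. \<bar>F (translate_path y (tagged_displacement \<epsilon> w)) - F (tagged_displacement \<epsilon> w)\<bar> \<partial>K)"
    by (rule integral_abs_bound)
  also have "\<dots> \<le> (\<integral>w. translation_modulus F \<delta> (tagged_displacement \<epsilon> w) \<partial>K)"
    by (intro integral_mono integrable_abs Bochner_Integration.integrable_diff int int_mod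
        translation_modulus_upper[OF F C y])
  finally show ?thesis using int by simp
qed

theorem theorem3p7:
  fixes \<mu> \<mu>\<^sub>0 :: "'n::finite config measure"
    and \<rho> :: "nat \<Rightarrow> (nat \<Rightarrow> real ^ 'n) \<Rightarrow> real"
    and P :: "'n config \<Rightarrow> 'n config cpath measure"
    and PXY :: "(real ^ 'n) \<times> 'n config \<Rightarrow> ((real ^ 'n) \<times> 'n config) cpath measure"
    and l :: "'n config \<Rightarrow> int \<Rightarrow> real ^ 'n"
    and X :: "int \<Rightarrow> 'n config cpath \<Rightarrow> (real ^ 'n) cpath"
    and a :: "'n config \<Rightarrow> real ^ 'n ^ 'n"
    and W :: "'w measure" and B :: "'w \<Rightarrow> (real ^ 'n) cpath"
  assumes "prob_space \<mu>" and "sets \<mu> = sets borel"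
    and "AE s in \<mu>. infinite_config s"
    \<comment> \<open>(i) -- (v)\<close>
    and "\<And>x. distr \<mu> borel (shift x) = \<mu>"
    and "closable \<mu> (D_mu \<mu>) (E_mu \<mu>)"
    and "\<And>n. n \<ge> 1 \<Longrightarrow> correlation_function \<mu> n (\<rho> n) \<and> locally_bounded n (\<rho> n)"
    and "Cap \<mu> {s. \<exists>x. mult s x \<ge> 2} = 0"
    and "reduced_palm \<mu> (one_point \<rho>) \<mu>\<^sub>0"
    and "closable (one_campbell (one_point \<rho>) \<mu>\<^sub>0) (D_one (one_point \<rho>) \<mu>\<^sub>0) (E_one (one_point \<rho>) \<mu>\<^sub>0)"
    \<comment> \<open>the unlabeled diffusion, the label and the labeled process\<close>
    and "diffusion P" and "associated \<mu> (D_mu \<mu>) (E_mu \<mu>) P" and "reversible \<mu> P"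
    and "is_label l" and "labeled_process (Cap \<mu>) P l X"
    \<comment> \<open>the tagged particle and environment process\<close>
    and "diffusion PXY" and "associated (lborel \<Otimes>\<^sub>M \<mu>\<^sub>0) (D_XY \<mu>\<^sub>0) (E_XY \<mu>\<^sub>0) PXY"
    \<comment> \<open>the fixed versions\<close>
    and "\<And>x s. distr (P s) borel (map_path (shift x)) = P (shift x s)"
    and "\<And>x x' s. distr (PXY (x, s)) borel centered_path = distr (PXY (x', s)) borel centered_path"
    and "\<And>x s j. s \<in> S_si \<Longrightarrow> mult s x = 1 \<Longrightarrow> l s j = x \<Longrightarrow>
           distr (P s) borel (X j) = distr (PXY (x, environment s x)) borel (map_path fst)"
    and "standard_Brownian_motion W B"
    \<comment> \<open>the function \<open>a\<close> of the invariance principle\<close>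
    and "a \<in> borel \<rightarrow>\<^sub>M borel" and "\<And>s. nonneg_definite (a s)"
    and "\<And>x (F :: (real ^ 'n) cpath \<Rightarrow> real) \<kappa>. continuous_on UNIV F \<Longrightarrow> bounded (range F) \<Longrightarrow> \<kappa> > 0 \<Longrightarrow>
           ((\<lambda>\<epsilon>. measure \<mu>\<^sub>0 {s.
               \<bar>(\<integral>w. F (map_path (\<lambda>y. y - \<epsilon> *\<^sub>R fst (path_at w 0)) (rescale \<epsilon> (map_path fst w)))
                   \<partial>PXY (x, s))
                 - (\<integral>\<omega>. F (map_path (\<lambda>y. matrix_sqrt (a s) *v y) (B \<omega>)) \<partial>W)\<bar> \<ge> \<kappa>})
             \<longlongrightarrow> 0) (at_right 0)"
  shows "\<forall>i. \<forall>F :: (real ^ 'n) cpath \<Rightarrow> real. continuous_on UNIV F \<longrightarrow> bounded (range F) \<longrightarrow>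
           (\<forall>\<kappa>>0. ((\<lambda>\<epsilon>. measure \<mu> {s \<in> S_si.
               \<bar>(\<integral>w. F (rescale \<epsilon> (X i w)) \<partial>P s)
                 - (\<integral>\<omega>. F (map_path (\<lambda>y. matrix_sqrt (a (environment s (l s i))) *v y) (B \<omega>)) \<partial>W)\<bar>
               \<ge> \<kappa>}) \<longlongrightarrow> 0) (at_right 0))"
proof (intro allI impI)
  fix i :: int and F :: "(real ^ 'n) cpath \<Rightarrow> real" and \<kappa> :: real
  assume F: "continuous_on UNIV F" and "bounded (range F)" and \<kappa>: "0 < \<kappa>"
  then obtain C where C: "\<And>w. \<bar>F w\<bar> \<le> C" by (auto simp: bounded_iff)
  note prob_\<mu> = assms(1) and sets_\<mu> = assms(2) and palm = assms(8) and label = assms(13)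
  interpret \<mu>: prob_space \<mu> by (rule prob_\<mu>)
  interpret \<mu>\<^sub>0: prob_space \<mu>\<^sub>0 using palm by (simp add: reduced_palm_def)
  have sets_\<mu>\<^sub>0: "sets \<mu>\<^sub>0 = sets borel" using palm by (simp add: reduced_palm_def)
  have space_\<mu>\<^sub>0: "space \<mu>\<^sub>0 = UNIV" using sets_eq_imp_space_eq[OF sets_\<mu>\<^sub>0] by simp
  have kernel: "P \<in> borel \<rightarrow>\<^sub>M prob_algebra borel" "PXY \<in> borel \<rightarrow>\<^sub>M prob_algebra borel"
    and start: "\<And>q. AE w in PXY q. path_at w 0 = q"
    using assms(10,15) unfolding diffusion_def by blast+
  have sets_P: "sets (P s) = sets borel" for s
    using measurable_space[OF kernel(1), of s] by (simp add: space_prob_algebra)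
  have PXY: "sets (PXY q) = sets borel" "prob_space (PXY q)" for q
    using measurable_space[OF kernel(2), of q] by (simp_all add: space_prob_algebra)
  have X: "X i \<in> borel \<rightarrow>\<^sub>M borel" using assms(14) unfolding labeled_process_def by blast
  have W: "prob_space W" "B \<in> W \<rightarrow>\<^sub>M borel"
    using assms(20) unfolding standard_Brownian_motion_def by blast+

  define H where "H G \<epsilon> e = (\<integral>w. G (tagged_displacement \<epsilon> w) \<partial>PXY (0, e))"
    for G :: "(real ^ 'n) cpath \<Rightarrow> real" and \<epsilon> e
  define J where "J G e = Brownian_mean W B G (matrix_sqrt (a e))"
    for G :: "(real ^ 'n) cpath \<Rightarrow> real" and e
  have invariance: "((\<lambda>\<epsilon>. measure \<mu>\<^sub>0 {e. \<bar>H G \<epsilon> e - J G e\<bar> \<ge> k}) \<longlongrightarrow> 0) (at_right 0)"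
    if "continuous_on UNIV G" "bounded (range G)" "k > 0" for G k
    using assms(23)[OF that, of 0]
    by (simp add: centered_rescale_eq H_def J_def Brownian_mean_def)
  have mH: "H G \<epsilon> \<in> borel_measurable borel" if "continuous_on UNIV G" for G \<epsilon>
  proof -
    have "(\<lambda>w :: ((real ^ 'n) \<times> 'n config) cpath. G (tagged_displacement \<epsilon> w)) \<in> borel_measurable borel"
      by (intro borel_measurable_continuous_onI continuous_on_compose2[OF that continuous_on_tagged_displacement]) auto
    from borel_measurable_kernel_integral[OF kernel(2) this, of 0] show ?thesis
      by (simp add: H_def[abs_def])
  qed
  have mJ: "J G \<in> borel_measurable borel" if "continuous_on UNIV G" "\<And>w. \<bar>G w\<bar> \<le> c" for G c
    unfolding J_def
    by (intro measurable_compose[OF measurable_compose[OF assms(21) borel_measurable_matrix_sqrt]]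
        borel_measurable_continuous_onI continuous_on_Brownian_mean[OF W that])

  have \<rho>1: "correlation_function \<mu> 1 (\<rho> 1)" "locally_bounded 1 (\<rho> 1)"
    using assms(6)[of 1] by simp_all
  define \<Delta> where "\<Delta> n = translation_modulus F (1 / real (Suc n))" for n
  have \<Delta>: "continuous_on UNIV (\<Delta> n)" "\<And>w. 0 \<le> \<Delta> n w" "\<And>w. \<bar>\<Delta> n w\<bar> \<le> 2 * C" for n
    using translation_modulus_nonneg[OF F C, of "1 / real (Suc n)"]
      translation_modulus_le[OF F C, of "1 / real (Suc n)"]
      continuous_on_translation_modulus[OF F C, of "1 / real (Suc n)"] by (simp_all add: \<Delta>_def)
  have \<Delta>_bdd: "bounded (range (\<Delta> n))" for n
    using \<Delta>(3)[of n] by (auto simp: bounded_iff intro!: exI[of _ "2 * C"])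

  let ?bad = "\<lambda>\<epsilon>. {s \<in> S_si. \<bar>(\<integral>w. F (rescale \<epsilon> (X i w)) \<partial>P s)
      - (\<integral>\<omega>. F (map_path (\<lambda>y. matrix_sqrt (a (environment s (l s i))) *v y) (B \<omega>)) \<partial>W)\<bar> \<ge> \<kappa>}"
  have labelled_mean: "(\<integral>w. F (rescale \<epsilon> (X i w)) \<partial>P s) =
      (\<integral>w. F (translate_path (\<epsilon> *\<^sub>R l s i) (tagged_displacement \<epsilon> w)) \<partial>PXY (0, environment s (l s i)))"
    if s: "s \<in> S_si" for s \<epsilon>
  proof -
    have mF: "(\<lambda>v. F (rescale \<epsilon> v)) \<in> borel_measurable borel"
      by (intro borel_measurable_continuous_onI continuous_on_compose2[OF F continuous_on_rescale]) auto
    have "(\<lambda>w. map_path fst w) \<in> PXY (l s i, environment s (l s i)) \<rightarrow>\<^sub>M borel"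
      unfolding measurable_cong_sets[OF PXY(1) refl]
      by (intro borel_measurable_continuous_onI continuous_on_map_path continuous_intros)
    moreover have "X i \<in> P s \<rightarrow>\<^sub>M borel" using X by (simp add: measurable_cong_sets[OF sets_P refl])
    ultimately have "(\<integral>w. F (rescale \<epsilon> (X i w)) \<partial>P s) =
        (\<integral>w. F (rescale \<epsilon> (map_path fst w)) \<partial>PXY (l s i, environment s (l s i)))"
      by (intro distr_eq_integral_eq[OF assms(19)[OF s label_point[OF label s] refl] _ _ mF])
    then show ?thesis
      using integral_tagged_path[OF PXY(1) start assms(18) F] by simp
  qed

  show "((\<lambda>\<epsilon>. measure \<mu> (?bad \<epsilon>)) \<longlongrightarrow> 0) (at_right 0)"
  proof (rule order_tendstoI)
    fix \<eta> :: real assume "\<eta> < 0"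
    then show "eventually (\<lambda>\<epsilon>. \<eta> < measure \<mu> (?bad \<epsilon>)) (at_right 0)"
      by (intro always_eventually allI) (rule less_le_trans[OF _ measure_nonneg])
  next
    fix \<eta> :: real assume \<eta>: "0 < \<eta>"
    obtain R :: nat where R: "measure \<mu> {s \<in> S_si. real R < norm (l s i)} < \<eta> / 2"
      using label_tight[OF prob_\<mu> sets_\<mu> label, of "\<eta> / 2" i] \<eta> by auto
    define c where "c = enn2real (\<integral>\<^sup>+x. ennreal (one_point \<rho> x) * indicator (cball 0 (real R)) x \<partial>lborel)"
    have c: "0 \<le> c" by (simp add: c_def)
    have "(\<lambda>n. c * measure \<mu>\<^sub>0 {e \<in> space \<mu>\<^sub>0. \<kappa> / 4 \<le> J (\<Delta> n) e}) \<longlonglongrightarrow> c * 0"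
    proof (intro tendsto_mult_left measure_upper_level_tendsto_0)
      show "finite_measure \<mu>\<^sub>0" by unfold_locales
      show "J (\<Delta> n) \<in> borel_measurable \<mu>\<^sub>0" for n
        unfolding measurable_cong_sets[OF sets_\<mu>\<^sub>0 refl] by (rule mJ[OF \<Delta>(1,3)])
      show "(\<lambda>n. J (\<Delta> n) e) \<longlonglongrightarrow> 0" for e
        unfolding J_def \<Delta>_def by (rule Brownian_mean_modulus_tendsto_0[OF W F C])
    qed (use \<kappa> in simp)
    then have "eventually (\<lambda>n. c * measure \<mu>\<^sub>0 {e \<in> space \<mu>\<^sub>0. \<kappa> / 4 \<le> J (\<Delta> n) e} < \<eta> / 4) sequentially"
      using \<eta> by (intro order_tendstoD) auto
    then obtain n where n: "c * measure \<mu>\<^sub>0 {e. \<kappa> / 4 \<le> J (\<Delta> n) e} < \<eta> / 4"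
      by (auto simp: eventually_sequentially space_\<mu>\<^sub>0)
    (* C1: the invariance principle for F is not yet accurate. C2: the same for the modulus of F.
       C3: the Brownian limit of that modulus is still large. Only C3 is free of \<epsilon>, and n makes it small. *)
    define C1 where "C1 \<epsilon> = {e. \<bar>H F \<epsilon> e - J F e\<bar> \<ge> \<kappa> / 2}" for \<epsilon>
    define C2 where "C2 \<epsilon> = {e. \<bar>H (\<Delta> n) \<epsilon> e - J (\<Delta> n) e\<bar> \<ge> \<kappa> / 4}" for \<epsilon>
    define C3 where "C3 = {e. \<kappa> / 4 \<le> J (\<Delta> n) e}"
    have "((\<lambda>\<epsilon>. c * measure \<mu>\<^sub>0 (C1 \<epsilon>) + c * measure \<mu>\<^sub>0 (C2 \<epsilon>)) \<longlongrightarrow> c * 0 + c * 0) (at_right 0)"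
      unfolding C1_def C2_def using \<kappa> \<open>bounded (range F)\<close>
      by (intro tendsto_add tendsto_mult_left invariance F \<Delta> \<Delta>_bdd) auto
    then have "eventually (\<lambda>\<epsilon>. c * measure \<mu>\<^sub>0 (C1 \<epsilon>) + c * measure \<mu>\<^sub>0 (C2 \<epsilon>) < \<eta> / 4) (at_right 0)"
      using \<eta> by (intro order_tendstoD) auto
    moreover have "eventually (\<lambda>\<epsilon>. \<epsilon> * real R < 1 / real (Suc n)) (at_right 0)"
    proof (rule order_tendstoD)
      show "((\<lambda>\<epsilon>. \<epsilon> * real R) \<longlongrightarrow> 0 * real R) (at_right 0)" by (intro tendsto_intros)
    qed simp
    moreover have "eventually (\<lambda>\<epsilon>::real. 0 < \<epsilon>) (at_right 0)"
      by (simp add: eventually_at_right_less)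
    ultimately show "eventually (\<lambda>\<epsilon>. measure \<mu> (?bad \<epsilon>) < \<eta>) (at_right 0)"
    proof eventually_elim
      case (elim \<epsilon>)
      let ?T = "{s \<in> S_si. real R < norm (l s i)}"
      have T: "?T \<in> sets \<mu>" using sets_label_norm[OF label] by (simp add: sets_\<mu>)
      have C123 [measurable]: "C1 \<epsilon> \<in> sets borel" "C2 \<epsilon> \<in> sets borel" "C3 \<in> sets borel"
        using mH[OF F, of \<epsilon>] mJ[OF F C] mH[OF \<Delta>(1)[of n], of \<epsilon>] mJ[OF \<Delta>(1,3)[of n]]
        unfolding C1_def C2_def C3_def by measurable
      have near: "\<exists>x\<in>cball 0 (real R). mult s x \<noteq> 0 \<and> environment s x \<in> C1 \<epsilon> \<union> C2 \<epsilon> \<union> C3"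
        if s: "s \<in> ?bad \<epsilon> - ?T" for s
      proof (rule bexI[of _ "l s i"], rule conjI)
        have S: "s \<in> S_si" and le: "norm (l s i) \<le> real R" using s by auto
        show "l s i \<in> cball 0 (real R)" using le by simp
        show "mult s (l s i) \<noteq> 0" using label_point[OF label S, of i] by simp
        let ?e = "environment s (l s i)"
        have "norm (\<epsilon> *\<^sub>R l s i) \<le> \<epsilon> * real R" using elim(3) le by simp
        then have "norm (\<epsilon> *\<^sub>R l s i) \<le> 1 / real (Suc n)" using elim(2) by linarith
        from translated_mean_le[OF PXY(2,1) F C this, of "(0, ?e)" \<epsilon>]
        have "\<bar>(\<integral>w. F (rescale \<epsilon> (X i w)) \<partial>P s) - H F \<epsilon> ?e\<bar> \<le> H (\<Delta> n) \<epsilon> ?e"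
          by (simp add: labelled_mean[OF S] H_def \<Delta>_def)
        moreover have "\<kappa> \<le> \<bar>(\<integral>w. F (rescale \<epsilon> (X i w)) \<partial>P s) - J F ?e\<bar>"
          using s by (simp add: J_def Brownian_mean_def)
        ultimately show "?e \<in> C1 \<epsilon> \<union> C2 \<epsilon> \<union> C3"
          unfolding C1_def C2_def C3_def Un_iff mem_Collect_eq by linarith
      qed
      show ?case
      (* A nonmeasurable set has measure 0 by convention, so only the measurable case needs the estimate. *)
      proof (cases "?bad \<epsilon> \<in> sets \<mu>")
        case False
        then show ?thesis using \<eta> by (simp add: measure_notin_sets)
      next
        case True
        have "measure \<mu> (?bad \<epsilon>) \<le> measure \<mu> (?T \<union> (?bad \<epsilon> - ?T))"
          using True T by (intro \<mu>.finite_measure_mono) auto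
        also have "\<dots> \<le> measure \<mu> ?T + measure \<mu> (?bad \<epsilon> - ?T)"
          using True T by (intro measure_Un_le) auto
        also have "measure \<mu> (?bad \<epsilon> - ?T) \<le> c * measure \<mu>\<^sub>0 (C1 \<epsilon> \<union> C2 \<epsilon> \<union> C3)"
          unfolding c_def
          by (rule measure_labelled_environment_le[OF sets_\<mu> palm intensity_finite(1)[where \<rho> = \<rho>, OF \<rho>1] _ intensity_finite(2)[where \<rho> = \<rho>, OF \<rho>1] _ _ near])
             (use True T in auto)
        also have "\<dots> \<le> c * (measure \<mu>\<^sub>0 (C1 \<epsilon>) + measure \<mu>\<^sub>0 (C2 \<epsilon>) + measure \<mu>\<^sub>0 C3)"
        proof (rule mult_left_mono[OF _ c])
          have "measure \<mu>\<^sub>0 (C1 \<epsilon> \<union> C2 \<epsilon> \<union> C3) \<le> measure \<mu>\<^sub>0 (C1 \<epsilon> \<union> C2 \<epsilon>) + measure \<mu>\<^sub>0 C3"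
            by (rule measure_Un_le) (simp_all add: sets_\<mu>\<^sub>0)
          moreover have "measure \<mu>\<^sub>0 (C1 \<epsilon> \<union> C2 \<epsilon>) \<le> measure \<mu>\<^sub>0 (C1 \<epsilon>) + measure \<mu>\<^sub>0 (C2 \<epsilon>)"
            by (rule measure_Un_le) (simp_all add: sets_\<mu>\<^sub>0)
          ultimately show "measure \<mu>\<^sub>0 (C1 \<epsilon> \<union> C2 \<epsilon> \<union> C3) \<le>
              measure \<mu>\<^sub>0 (C1 \<epsilon>) + measure \<mu>\<^sub>0 (C2 \<epsilon>) + measure \<mu>\<^sub>0 C3" by linarith
        qed
        finally have "measure \<mu> (?bad \<epsilon>) \<le> measure \<mu> ?T +
            (c * measure \<mu>\<^sub>0 (C1 \<epsilon>) + c * measure \<mu>\<^sub>0 (C2 \<epsilon>) + c * measure \<mu>\<^sub>0 C3)"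
          by (simp add: distrib_left)
        then show ?thesis using R n elim(1) unfolding C3_def by linarith
      qed
    qed
  qed
qed

end
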